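(* Every $(K_3, S_{1,2,2})$-free graph has linear rank-width at most $58$.
   Context: All graphs are finite, without loops or multiple edges. A graph is $(H_1,\ldots,H_p)$-free if it contains none of $H_1,\ldots,H_p$ as an induced subgraph. $K_3$ is the triangle. $S_{1,2,2}$ is the graph obtained from the claw $K_{1,3}$ by subdividing two of its three edges exactly once each (so it has $6$ vertices). For a graph $G$ with adjacency matrix $A_G$ and $X\subseteq V(G)$, let $\mathrm{cutrk}_G(X)$ be the rank over the binary field of the submatrix $A_G[X,V(G)\setminus X]$ with rows $X$ and columns $V(G)\setminus X$. The width of a linear ordering $(x_1,\ldots,x_n)$ of $V(G)$ is $\max_{1\le i\le n}\mathrm{cutrk}_G(\{x_1,\ldots,x_i\})$. The linear rank-width of $G$ is the minimum width over all linear orderings of $V(G)$. *)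

theory Defs
  imports
    "Graph_Theory.Pair_Digraph"
    "Graph_Theory.Digraph_Isomorphism"
    "HOL-Combinatorics.Multiset_Permutations"
    "HOL-Library.Function_Algebras"
    "HOL-Library.Z2"
begin

text \<open>
  A finite simple graph is a \<open>pair_graph\<close>: a finite, loopless, symmetric digraph whose
  arcs are ordered pairs of vertices, an edge \<open>uv\<close> being the two arcs \<open>(u, v)\<close> and \<open>(v, u)\<close>.
\<close>

definition induced_free :: "'b pair_pre_digraph set \<Rightarrow> 'a pair_pre_digraph \<Rightarrow> bool" where
  "induced_free \<F> G \<longleftrightarrow>
    \<not> (\<exists>F\<in>\<F>. \<exists>H. induced_subgraph H (with_proj G) \<and> digraph_iso H (with_proj F))"

definition K_3 :: "nat pair_pre_digraph" where
  "K_3 = \<lparr> pverts = {0, 1, 2}, parcs = {(u, v). u \<in> {0, 1, 2} \<and> v \<in> {0, 1, 2} \<and> u \<noteq> v} \<rparr>"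

definition claw :: "nat pair_pre_digraph" where
  "claw = \<lparr> pverts = {0, 1, 2, 3}, parcs = {0} \<times> {1, 2, 3} \<union> {1, 2, 3} \<times> {0} \<rparr>"

definition S_1_2_2 :: "nat pair_pre_digraph" where
  "S_1_2_2 = subdivide (subdivide claw (0, 2) 4) (0, 3) 5"

text \<open>
  The rank of a matrix is the dimension of its row space. The rows of the submatrix with row
  set \<open>R\<close> and column set \<open>C\<close> are represented by functions that vanish outside \<open>C\<close>.
\<close>

definition fun_scale :: "'f :: field \<Rightarrow> ('c \<Rightarrow> 'f) \<Rightarrow> 'c \<Rightarrow> 'f" where
  "fun_scale c v = (\<lambda>j. c * v j)"

global_interpretation fun_space: vector_space fun_scale
  by unfold_locales (auto simp: fun_scale_def fun_eq_iff algebra_simps)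

definition submatrix_rank :: "('r \<Rightarrow> 'c \<Rightarrow> 'f :: field) \<Rightarrow> 'r set \<Rightarrow> 'c set \<Rightarrow> nat" where
  "submatrix_rank A R C = fun_space.dim ((\<lambda>i j. if j \<in> C then A i j else 0) ` R)"

text \<open>The type \<open>bit\<close> is the field with two elements.\<close>

definition adjacency_matrix :: "'a pair_pre_digraph \<Rightarrow> 'a \<Rightarrow> 'a \<Rightarrow> bit" where
  "adjacency_matrix G u v = (if (u, v) \<in> parcs G then 1 else 0)"

definition cutrk :: "'a pair_pre_digraph \<Rightarrow> 'a set \<Rightarrow> nat" where
  "cutrk G X = submatrix_rank (adjacency_matrix G) X (pverts G - X)"

text \<open>
  On \<open>nat\<close> the supremum of a finite nonempty set is its maximum, and the supremum of the empty
  set is \<open>0\<close>; so the empty ordering of the graph without vertices has width \<open>0\<close>.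
\<close>

definition ordering_width :: "'a pair_pre_digraph \<Rightarrow> 'a list \<Rightarrow> nat" where
  "ordering_width G xs = (SUP i\<in>{1..length xs}. cutrk G (set (take i xs)))"

definition linear_rank_width :: "'a pair_pre_digraph \<Rightarrow> nat" where
  "linear_rank_width G = Min (ordering_width G ` permutations_of_set (pverts G))"

end

theory Submission
  imports Defs
begin

text \<open>
  It suffices to order each connected component. A vertex class partition and a default adjacency
  between the classes change every cut-rank by at most the number of classes, so only the
  deviations from the default matter.

  If there is a five-cycle, every vertex sees either exactly one vertex of the cycle or exactly two at
  distance two, and the deviations live in five disjoint tripartite pieces, each of which is a
  threshold graph of a linear order.
  If there is none, replacing single vertices of an induced subgraph by others with the same
  neighbours in it shows: an induced cycle of length seven or an induced path on seven vertices
  makes the graph a blow-up of a cycle or a path, which is ordered along that cycle or path;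
  otherwise the graph is bipartite and its bipartite complement is a disjoint union of chain graphs
  (bipartite graphs without an induced \<open>2K\<^sub>2\<close>).
\<close>

section \<open>Cut-rank and vertex orderings\<close>

text \<open>With a five-cycle, the obstacle is that the deviations couple three vertex classes at
  once, so ordering each pair of classes well is not enough. Orienting the pairs of deviant vertices
  from different classes of such a triple gives a tripartite tournament; the forbidden subgraphs
  rule out its directed triangles and its alternating four-cycles, and this is enough for a source
  in every nonempty subset. Neighbouring triples share a class, but no vertex deviates in both, so
  one ordering serves all five. For prefixes closed under predecessors, each of the ten classes
  needs one default row and one deviation set, hence 10 + 10 = 20, within the stated 58; the cases
  without a five-cycle need at most 7. Cycles and paths are given by adjacencies and few
  non-adjacencies: short chords are excluded because there are no triangles and, later, no closed
  walks of length five. A vertex can therefore replace another after a few adjacency checks, without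
  any discussion of distinctness.\<close>

definition cut_rank :: "'a set \<Rightarrow> ('a \<Rightarrow> 'a \<Rightarrow> bool) \<Rightarrow> 'a set \<Rightarrow> nat" where
  "cut_rank V E X = submatrix_rank (\<lambda>u v. if E u v then 1 else 0 :: bit) X (V - X)"

text \<open>A witness ordering over a bare vertex set and relation makes the bound easy to transfer
  to unions of components. The index runs over all naturals; beyond the length, \<open>take\<close>
  returns the whole list.\<close>

definition lrw_le :: "nat \<Rightarrow> 'a set \<Rightarrow> ('a \<Rightarrow> 'a \<Rightarrow> bool) \<Rightarrow> bool" where
  "lrw_le k V E \<longleftrightarrow> (\<exists>xs. distinct xs \<and> set xs = V \<and> (\<forall>i. cut_rank V E (set (take i xs)) \<le> k))"

lemma linear_rank_width_leI:
  assumes "finite (pverts G)" "lrw_le k (pverts G) (\<lambda>u v. (u, v) \<in> parcs G)"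
  shows "linear_rank_width G \<le> k"
proof -
  obtain xs where xs: "distinct xs" "set xs = pverts G"
    and le: "\<And>i. cut_rank (pverts G) (\<lambda>u v. (u, v) \<in> parcs G) (set (take i xs)) \<le> k"
    using assms(2) unfolding lrw_le_def by blast
  have cut: "cutrk G X = cut_rank (pverts G) (\<lambda>u v. (u, v) \<in> parcs G) X" for X
    by (simp add: cutrk_def cut_rank_def adjacency_matrix_def[abs_def])
  have "ordering_width G xs \<le> k"
  proof (cases "xs = []")
    case True
    then show ?thesis by (simp add: ordering_width_def)
  next
    case False
    then show ?thesis unfolding ordering_width_def using le
      by (intro cSUP_least) (auto simp: cut Suc_le_eq)
  qed
  moreover have "xs \<in> permutations_of_set (pverts G)"
    using xs by (simp add: permutations_of_set_def)
  ultimately show ?thesis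
    unfolding linear_rank_width_def using assms(1)
    by (meson Min_le finite_imageI finite_permutations_of_set image_eqI order_trans)
qed

text \<open>Over the two-element field, disagreement of truth values is addition. So every row is
  the sum of a default row \<open>R c\<close> and a deviation row, and all rows lie in the span of
  \<open>card C + card D\<close> vectors. The set \<open>{}\<close> stands for the zero vector and
  is not counted.\<close>

lemma cut_rank_leI:
  fixes V :: "'a set"
  assumes C: "finite C" and D: "finite D"
    and row: "\<And>x. x \<in> X \<Longrightarrow> \<exists>c\<in>C. \<exists>d\<in>insert {} D. \<forall>y\<in>V - X. E x y \<longleftrightarrow> (R c y \<noteq> (y \<in> d))"
  shows "cut_rank V E X \<le> card C + card D"
proof -
  define vec :: "'a set \<Rightarrow> 'a \<Rightarrow> bit" where "vec S = (\<lambda>j. if j \<in> (V - X) \<inter> S then 1 else 0)" for S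
  let ?W = "(\<lambda>c. vec {y. R c y}) ` C \<union> vec ` D"
  have fin: "finite ?W" using C D by simp
  have "(\<lambda>i j. if j \<in> V - X then if E i j then 1 else 0 else (0 :: bit)) ` X \<subseteq> fun_space.span ?W"
  proof
    fix r assume "r \<in> (\<lambda>i j. if j \<in> V - X then if E i j then 1 else 0 else (0 :: bit)) ` X"
    then obtain x where x: "x \<in> X" and r: "r = (\<lambda>j. if j \<in> V - X then if E x j then 1 else 0 else 0)"
      by blast
    obtain c d where c: "c \<in> C" and d: "d \<in> insert {} D"
      and cd: "\<And>y. y \<in> V - X \<Longrightarrow> E x y \<longleftrightarrow> (R c y \<noteq> (y \<in> d))"
      using row[OF x] by blast
    have eq: "r = vec {y. R c y} + vec d"
      using cd by (auto simp: r vec_def fun_eq_iff)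
    have "vec {y. R c y} \<in> fun_space.span ?W"
      using c by (intro fun_space.span_base) auto
    moreover have "vec d \<in> fun_space.span ?W"
    proof (cases "d \<in> D")
      case True
      then show ?thesis by (intro fun_space.span_base) auto
    next
      case False
      then have "vec d = 0" using d by (auto simp: vec_def fun_eq_iff)
      then show ?thesis by (simp add: fun_space.span_zero)
    qed
    ultimately show "r \<in> fun_space.span ?W"
      unfolding eq by (rule fun_space.span_add)
  qed
  then have "cut_rank V E X \<le> card ?W"
    unfolding cut_rank_def submatrix_rank_def using fin by (rule fun_space.dim_le_card)
  also have "\<dots> \<le> card C + card D"
    by (meson card_Un_le card_image_le add_mono C D order_trans)
  finally show ?thesis .
qed

text \<open>The ordering is grown one vertex at a time. An invariant of prefix sets that can always
  be extended suffices, so the later arguments handle sets instead of lists.\<close>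

lemma lrw_leI:
  assumes V: "finite V" and empty: "\<Phi> {}"
    and step: "\<And>X. X \<subset> V \<Longrightarrow> \<Phi> X \<Longrightarrow> \<exists>v\<in>V - X. \<Phi> (insert v X)"
    and cut_rank: "\<And>X. X \<subseteq> V \<Longrightarrow> \<Phi> X \<Longrightarrow> cut_rank V E X \<le> k"
  shows "lrw_le k V E"
proof -
  have "\<exists>xs. distinct xs \<and> set xs \<subseteq> V \<and> length xs = n \<and> (\<forall>i. \<Phi> (set (take i xs)))" if "n \<le> card V" for n
    using that
  proof (induction n)
    case 0
    then show ?case using empty by simp
  next
    case (Suc n)
    then obtain xs where xs: "distinct xs" "set xs \<subseteq> V" "length xs = n" "\<And>i. \<Phi> (set (take i xs))"
      by auto
    have "set xs \<noteq> V" using xs(1,3) Suc.prems distinct_card by fastforce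
    moreover have "\<Phi> (set xs)" using xs(4)[of n] xs(3) by simp
    ultimately obtain v where v: "v \<in> V - set xs" "\<Phi> (insert v (set xs))"
      using step xs(2) by blast
    have "\<Phi> (set (take i (xs @ [v])))" for i
      using v(2) xs(3) xs(4)[of i] \<open>\<Phi> (set xs)\<close> by (cases "i - n") auto
    then show ?case
      using xs v by (intro exI[of _ "xs @ [v]"]) auto
  qed
  from this[of "card V"] obtain xs where xs: "distinct xs" "set xs \<subseteq> V" "length xs = card V"
    "\<And>i. \<Phi> (set (take i xs))"
    by auto
  have "set xs = V" using xs V by (metis card_subset_eq distinct_card)
  moreover have "cut_rank V E (set (take i xs)) \<le> k" for i
    using cut_rank[OF _ xs(4)[of i]] set_take_subset[of i xs] xs(2) by (meson order_trans)
  ultimately show ?thesis unfolding lrw_le_def using xs(1) by blast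
qed

lemma lrw_le_mono: "lrw_le k V E \<Longrightarrow> k \<le> l \<Longrightarrow> lrw_le l V E"
  unfolding lrw_le_def by (metis order_trans)

lemma cut_rank_disjoint_union:
  assumes "V1 \<inter> V2 = {}"
    and no: "\<And>x y. x \<in> V1 \<Longrightarrow> y \<in> V2 \<Longrightarrow> \<not> E x y \<and> \<not> E y x"
  shows "X \<subseteq> V1 \<Longrightarrow> cut_rank (V1 \<union> V2) E X = cut_rank V1 E X"
    and "X \<subseteq> V2 \<Longrightarrow> cut_rank (V1 \<union> V2) E (V1 \<union> X) = cut_rank V2 E X"
proof -
  assume X: "X \<subseteq> V1"
  have "(\<lambda>i j. if j \<in> V1 \<union> V2 - X then if E i j then 1 else 0 else (0::bit)) ` X
      = (\<lambda>i j. if j \<in> V1 - X then if E i j then 1 else 0 else (0::bit)) ` X"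
    using X no assms(1) by (intro image_cong refl) (auto simp: fun_eq_iff)
  then show "cut_rank (V1 \<union> V2) E X = cut_rank V1 E X"
    by (simp add: cut_rank_def submatrix_rank_def)
next
  assume X: "X \<subseteq> V2"
  define f where "f V Y = (\<lambda>i j. if j \<in> V - Y then if E i j then 1 else 0 else (0::bit))" for V Y
  have "f (V1 \<union> V2) (V1 \<union> X) i = f V2 X i" if "i \<in> X" for i
    using X that no assms(1) by (auto simp: f_def fun_eq_iff)
  \<comment> \<open>Once all of \<open>V1\<close> is on the left, its rows vanish, and adding the
    zero vector does not change a span.\<close>
  moreover have "f (V1 \<union> V2) (V1 \<union> X) i = 0" if "i \<in> V1" for i
    using X that no assms(1) by (auto simp: f_def fun_eq_iff)
  ultimately have "f (V1 \<union> V2) (V1 \<union> X) ` (V1 \<union> X) \<union> {0} = f V2 X ` X \<union> {0}"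
    by (auto simp: image_Un image_iff)
  then have "fun_space.dim (f (V1 \<union> V2) (V1 \<union> X) ` (V1 \<union> X)) = fun_space.dim (f V2 X ` X)"
    by (metis Un_insert_right fun_space.dim_span fun_space.span_insert_0 sup_bot.right_neutral)
  then show "cut_rank (V1 \<union> V2) E (V1 \<union> X) = cut_rank V2 E X"
    by (simp add: cut_rank_def submatrix_rank_def f_def)
qed

lemma lrw_le_disjoint_union:
  assumes disj: "V1 \<inter> V2 = {}"
    and no: "\<And>x y. x \<in> V1 \<Longrightarrow> y \<in> V2 \<Longrightarrow> \<not> E x y \<and> \<not> E y x"
    and "lrw_le k V1 E" "lrw_le k V2 E"
  shows "lrw_le k (V1 \<union> V2) E"
proof -
  obtain xs ys where xs: "distinct xs" "set xs = V1" "\<And>i. cut_rank V1 E (set (take i xs)) \<le> k"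
    and ys: "distinct ys" "set ys = V2" "\<And>i. cut_rank V2 E (set (take i ys)) \<le> k"
    using assms(3,4) unfolding lrw_le_def by blast
  have "cut_rank (V1 \<union> V2) E (set (take i (xs @ ys))) \<le> k" for i
  proof (cases "i \<le> length xs")
    case True
    then show ?thesis
      using cut_rank_disjoint_union(1)[OF disj no, where X = "set (take i xs)"] xs(2,3) set_take_subset[of i xs] by simp
  next
    case False
    then have "set (take i (xs @ ys)) = V1 \<union> set (take (i - length xs) ys)"
      using xs(2) by simp
    then show ?thesis
      using cut_rank_disjoint_union(2)[OF disj no, where X = "set (take (i - length xs) ys)"] ys(2,3)
        set_take_subset[of "i - length xs" ys] by simp
  qed
  then show ?thesis
    unfolding lrw_le_def using xs ys disj by (intro exI[of _ "xs @ ys"]) auto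
qed

lemma cut_rank_cong: "(\<And>x y. x \<in> V \<Longrightarrow> y \<in> V \<Longrightarrow> E x y = E' x y) \<Longrightarrow> X \<subseteq> V \<Longrightarrow> cut_rank V E X = cut_rank V E' X"
  unfolding cut_rank_def submatrix_rank_def
  by (intro arg_cong[where f = fun_space.dim] image_cong) (auto simp: fun_eq_iff)

lemma lrw_le_cong: "(\<And>x y. x \<in> V \<Longrightarrow> y \<in> V \<Longrightarrow> E x y = E' x y) \<Longrightarrow> lrw_le k V E \<longleftrightarrow> lrw_le k V E'"
  unfolding lrw_le_def using cut_rank_cong[of V E E'] set_take_subset by (metis (no_types, lifting))


section \<open>The forbidden subgraphs\<close>

text \<open>The arc map is forced to be \<open>map_prod g g\<close>. The isomorphism is built from
  \<open>F\<close> to the subgraph on the image of \<open>g\<close>, while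
  \<open>induced_free\<close> asks for the opposite direction; hence the swap at the end.\<close>

lemma not_induced_freeI:
  assumes F: "F \<in> \<F>" "parcs F \<subseteq> pverts F \<times> pverts F"
    and G: "pair_wf_digraph G"
    and g: "inj_on g (pverts F)" "g ` pverts F \<subseteq> pverts G"
    and arcs: "\<And>u v. u \<in> pverts F \<Longrightarrow> v \<in> pverts F \<Longrightarrow> (u, v) \<in> parcs F \<longleftrightarrow> (g u, g v) \<in> parcs G"
  shows "\<not> induced_free \<F> G"
proof -
  let ?H = "\<lparr>verts = g ` pverts F, arcs = {e \<in> parcs G. fst e \<in> g ` pverts F \<and> snd e \<in> g ` pverts F},
    tail = fst, head = snd\<rparr>"
  let ?h = "\<lparr>iso_verts = g, iso_arcs = map_prod g g, iso_head = snd, iso_tail = fst\<rparr>"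
  have wfF: "wf_digraph (with_proj F)"
    using F by (auto simp: wf_digraph_def)
  have wfG: "wf_digraph (with_proj G)"
    using G by (auto simp: wf_digraph_def pair_wf_digraph_def)
  have "wf_digraph ?H"
    by (auto simp: wf_digraph_def)
  then have ind: "induced_subgraph ?H (with_proj G)"
    using g wfG by (auto simp: induced_subgraph_def subgraph_def compatible_def)
  have "inj_on (map_prod g g) (parcs F)"
    using map_prod_inj_on[OF g(1) g(1)] F(2) inj_on_subset by blast
  then have "pre_digraph.digraph_isomorphism (with_proj F) ?h"
    using wfF g by (auto simp: pre_digraph.digraph_isomorphism_def)
  moreover have "map_prod g g ` parcs F = arcs ?H"
  proof (intro equalityI subsetI)
    fix e assume "e \<in> map_prod g g ` parcs F"
    then obtain u v where "(u, v) \<in> parcs F" "e = (g u, g v)" by auto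
    then show "e \<in> arcs ?H" using F(2) arcs[of u v] by auto
  next
    fix e assume "e \<in> arcs ?H"
    then obtain u v where "u \<in> pverts F" "v \<in> pverts F" "e = (g u, g v)" "e \<in> parcs G"
      by (cases e) auto
    then show "e \<in> map_prod g g ` parcs F" using arcs[of u v] by (auto intro!: rev_image_eqI)
  qed
  ultimately have "digraph_iso (with_proj F) ?H"
    unfolding digraph_iso_def app_iso_def by (intro exI[of _ ?h]) simp
  then have "digraph_iso ?H (with_proj F)"
    using digraph_iso_swap wfF by blast
  then show ?thesis
    using ind F(1) unfolding induced_free_def by blast
qed

text \<open>The subdivisions insert 4 between 0 and 2, and 5 between 0 and 3. So the centre is 0,
  the short leg is 1, and the long legs run 0, 4, 2 and 0, 5, 3.\<close>

lemma S_1_2_2_simps: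
  "parcs S_1_2_2 = {(0,1),(1,0),(0,4),(4,0),(4,2),(2,4),(0,5),(5,0),(5,3),(3,5)}"
  "pverts S_1_2_2 = {0,1,2,3,4,5}"
  by (auto simp: S_1_2_2_def claw_def)

text \<open>
  In a triangle-free graph the rule \<open>skew\<close> expresses that no \<open>S\<^sub>1\<^sub>,\<^sub>2\<^sub>,\<^sub>2\<close> with centre \<open>c\<close>, short leg \<open>a\<close> and
  long legs \<open>b b'\<close> and \<open>d d'\<close> is induced; if two of the six vertices coincide or are otherwise adjacent,
  its conclusion holds anyway.
\<close>

locale skew_free =
  fixes V :: "'a set" and E :: "'a \<Rightarrow> 'a \<Rightarrow> bool"
  assumes finV: "finite V"
    and E_in: "E x y \<Longrightarrow> x \<in> V"
    and sym: "E x y \<Longrightarrow> E y x"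
    and tri: "E x y \<Longrightarrow> E y z \<Longrightarrow> E x z \<Longrightarrow> False"
    and skew: "E c a \<Longrightarrow> E c b \<Longrightarrow> E c d \<Longrightarrow> E b b' \<Longrightarrow> E d d' \<Longrightarrow>
      E a b' \<or> E a d' \<or> E b d' \<or> E d b' \<or> E b' d'"

lemma skew_free_of_induced_free:
  assumes "pair_graph G" "induced_free {K_3, S_1_2_2} G"
  shows "skew_free (pverts G) (\<lambda>u v. (u, v) \<in> parcs G)"
proof -
  interpret pair_graph G by fact
  have s: "(u, v) \<in> parcs G \<Longrightarrow> (v, u) \<in> parcs G" for u v
    by (rule arcs_symmetric)
  have tri: False if "(x, y) \<in> parcs G" "(y, z) \<in> parcs G" "(x, z) \<in> parcs G" for x y z
  proof -
    have ne: "x \<noteq> y" "y \<noteq> z" "x \<noteq> z" using that pair_no_loops by fastforce+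
    have sy: "(y, x) \<in> parcs G" "(z, y) \<in> parcs G" "(z, x) \<in> parcs G"
      using that s by blast+
    have loop: "(u, u) \<notin> parcs G" for u using pair_no_loops by fastforce
    have V: "x \<in> pverts G" "y \<in> pverts G" "z \<in> pverts G"
      using that wellformed' by blast+
    have "\<not> induced_free {K_3, S_1_2_2} G"
    proof (rule not_induced_freeI[of K_3 _ _ "\<lambda>n. [x, y, z] ! n"])
      show "inj_on ((!) [x, y, z]) (pverts K_3)"
        using ne by (auto simp: K_3_def inj_on_def)
    next
      fix u v assume "u \<in> pverts K_3" "v \<in> pverts K_3"
      then show "(u, v) \<in> parcs K_3 \<longleftrightarrow> ([x, y, z] ! u, [x, y, z] ! v) \<in> parcs G"
        using that sy loop by (auto simp: K_3_def)
    qed (use V in \<open>auto simp: K_3_def pair_wf_digraph_axioms\<close>)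
    with assms show False by simp
  qed
  have skew: "(a,b') \<in> parcs G \<or> (a,d') \<in> parcs G \<or> (b,d') \<in> parcs G \<or> (d,b') \<in> parcs G \<or> (b',d') \<in> parcs G"
    if that: "(c,a) \<in> parcs G" "(c,b) \<in> parcs G" "(c,d) \<in> parcs G" "(b,b') \<in> parcs G" "(d,d') \<in> parcs G"
    for a b c d b' d'
  proof (rule ccontr)
    assume n: "\<not> ?thesis"
    have loop: "(u, u) \<notin> parcs G" for u using pair_no_loops by fastforce
    have n': "(c,b') \<notin> parcs G" "(c,d') \<notin> parcs G" "(a,b) \<notin> parcs G" "(a,d) \<notin> parcs G" "(b,d) \<notin> parcs G"
      using tri[of c b b'] tri[of c d d'] tri[of c a b] tri[of c a d] tri[of c b d] that by auto
    have inv: "(b',a) \<notin> parcs G" "(d',a) \<notin> parcs G" "(d',b) \<notin> parcs G" "(b',d) \<notin> parcs G" "(d',b') \<notin> parcs G"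
      "(b',c) \<notin> parcs G" "(d',c) \<notin> parcs G" "(b,a) \<notin> parcs G" "(d,a) \<notin> parcs G" "(d,b) \<notin> parcs G"
      "(a,c) \<in> parcs G" "(b,c) \<in> parcs G" "(d,c) \<in> parcs G" "(b',b) \<in> parcs G" "(d',d) \<in> parcs G"
      using n n' that s by blast+
    have dist: "distinct [c,a,b',d',b,d]"
      using that n n' inv loop by auto
    have "\<not> induced_free {K_3, S_1_2_2} G"
    \<comment> \<open>The list follows the numbering of \<open>S_1_2_2\<close>, in which the inner
      vertices 4 and 5 of the long legs come last.\<close>
    proof (rule not_induced_freeI[of S_1_2_2 _ _ "\<lambda>n. [c,a,b',d',b,d] ! n"])
      show "inj_on ((!) [c, a, b', d', b, d]) (pverts S_1_2_2)"
        using dist unfolding S_1_2_2_simps by (auto simp: inj_on_def)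
    next
      show "(!) [c, a, b', d', b, d] ` pverts S_1_2_2 \<subseteq> pverts G"
        using that wellformed' unfolding S_1_2_2_simps by auto
    next
      fix u v assume "u \<in> pverts S_1_2_2" "v \<in> pverts S_1_2_2"
      then show "(u, v) \<in> parcs S_1_2_2 \<longleftrightarrow> ([c, a, b', d', b, d] ! u, [c, a, b', d', b, d] ! v) \<in> parcs G"
        unfolding S_1_2_2_simps by (elim insertE emptyE; hypsubst; insert that n n' inv loop; simp)
    qed (auto simp: S_1_2_2_simps pair_wf_digraph_axioms)
    with assms show False by simp
  qed
  show ?thesis
  proof unfold_locales
    show "finite (pverts G)" by (rule pair_finite_verts)
    show "(x, y) \<in> parcs G \<Longrightarrow> x \<in> pverts G" for x y by (rule in_arcsD1)
    show "(x, y) \<in> parcs G \<Longrightarrow> (y, x) \<in> parcs G" for x y by (rule s)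
    show "(x, y) \<in> parcs G \<Longrightarrow> (y, z) \<in> parcs G \<Longrightarrow> (x, z) \<in> parcs G \<Longrightarrow> False" for x y z by (rule tri)
    show "(c, a) \<in> parcs G \<Longrightarrow> (c, b) \<in> parcs G \<Longrightarrow> (c, d) \<in> parcs G \<Longrightarrow> (b, b') \<in> parcs G \<Longrightarrow> (d, d') \<in> parcs G \<Longrightarrow>
      (a, b') \<in> parcs G \<or> (a, d') \<in> parcs G \<or> (b, d') \<in> parcs G \<or> (d, b') \<in> parcs G \<or> (b', d') \<in> parcs G" for a b c d b' d'
      by (rule skew)
  qed
qed



section \<open>Disjoint unions of chain graphs\<close>

lemma finite_ex_max:
  fixes f :: "'a \<Rightarrow> nat"
  assumes "finite A" "A \<noteq> {}"
  obtains a where "a \<in> A" "\<And>b. b \<in> A \<Longrightarrow> f b \<le> f a"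
  using obtains_MAX[OF assms, of f] assms(1) by (metis Max_ge finite_imageI imageI)

lemma finite_ex_min:
  fixes f :: "'a \<Rightarrow> nat"
  assumes "finite A" "A \<noteq> {}"
  obtains a where "a \<in> A" "\<And>b. b \<in> A \<Longrightarrow> f a \<le> f b"
  using obtains_MIN[OF assms, of f] assms(1) by (metis Min_le finite_imageI imageI)

text \<open>
  The ordering of a disjoint union of chain graphs is built greedily. The first half of the invariant
  \<open>\<Phi>\<close> says that the nonzero rows of the cut are all equal, so that its rank is at most one; the second
  half makes sure that in a component that is under way the vertices with larger neighbourhoods come first.
\<close>

lemma chain_components_order:
  fixes H :: "'a \<Rightarrow> 'a \<Rightarrow> bool"
  assumes V: "finite V" and HV: "\<And>x y. H x y \<Longrightarrow> x \<in> V" and Hsym: "\<And>x y. H x y \<Longrightarrow> H y x"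
    and irr: "\<And>x. \<not> H x x"
    and cmp: "\<And>u v w. H u w \<Longrightarrow> H v w \<Longrightarrow> Collect (H u) \<subseteq> Collect (H v) \<or> Collect (H v) \<subseteq> Collect (H u)"
  defines "\<Phi> \<equiv> \<lambda>X. (\<forall>x\<in>X. \<forall>x'\<in>X. \<forall>y\<in>V - X. \<forall>y'\<in>V - X. H x y \<longrightarrow> H x' y' \<longrightarrow> H x' y) \<and>
    (\<forall>x\<in>X. \<forall>a\<in>V - X. \<forall>y\<in>V - X. \<forall>b. H x y \<longrightarrow> H x b \<longrightarrow> H a b \<longrightarrow> Collect (H a) \<subseteq> Collect (H x))"
  assumes X: "X \<subset> V" "\<Phi> X"
  shows "\<exists>v\<in>V - X. \<Phi> (insert v X)"
proof -
  define N where "N u = Collect (H u)" for u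
  have finN: "finite (N u)" for u
    unfolding N_def by (rule finite_subset[OF _ V]) (use HV Hsym in blast)
  \<comment> \<open>\<open>x\<close> and \<open>z\<close> share the neighbour \<open>y\<close>; if
    they were adjacent, comparability of their neighbourhoods would make one of them adjacent to
    itself.\<close>
  have no_tri: False if "H x y" "H y z" "H x z" for x y z
    using cmp[OF that(1) Hsym[OF that(2)]] that(3) Hsym[OF that(3)] irr by blast
  have cmp': "N u \<subseteq> N v" if "H u w" "H v w" "card (N u) \<le> card (N v)" for u v w
    using cmp[OF that(1,2)] that(3) card_seteq[OF finN[of u], of "N v"] unfolding N_def by auto
  have thin: "H x' y" if "x \<in> X" "x' \<in> X" "y \<in> V - X" "y' \<in> V - X" "H x y" "H x' y'" for x x' y y'
    using X(2) that unfolding \<Phi>_def by blast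
  have inv: "N a \<subseteq> N x" if "x \<in> X" "a \<in> V - X" "y \<in> V - X" "H x y" "H x b" "H a b" for x a y b
    using X(2) that unfolding \<Phi>_def N_def by blast
  have \<Phi>I: "\<Phi> Z" if "\<And>x x' y y'. x \<in> Z \<Longrightarrow> x' \<in> Z \<Longrightarrow> y \<in> V - Z \<Longrightarrow> y' \<in> V - Z \<Longrightarrow> H x y \<Longrightarrow> H x' y' \<Longrightarrow> H x' y"
    "\<And>x a y b. x \<in> Z \<Longrightarrow> a \<in> V - Z \<Longrightarrow> y \<in> V - Z \<Longrightarrow> H x y \<Longrightarrow> H x b \<Longrightarrow> H a b \<Longrightarrow> N a \<subseteq> N x" for Z
    unfolding \<Phi>_def using that unfolding N_def by blast
  \<comment> \<open>A vertex whose neighbours are all placed can be added at no cost. Otherwise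
    either no edge crosses the cut, and a new component is started with a vertex of largest
    neighbourhood, or a component under way is continued.\<close>
  consider (free) b where "b \<in> V - X" "N b \<subseteq> X"
    | (active) x y where "x \<in> X" "y \<in> V - X" "H x y" "\<And>b. b \<in> V - X \<Longrightarrow> \<not> N b \<subseteq> X"
    | (none) "\<And>x y. x \<in> X \<Longrightarrow> y \<in> V - X \<Longrightarrow> \<not> H x y"
    by blast
  then show ?thesis
  proof cases
    case free
    have "\<Phi> (insert b X)"
    proof (rule \<Phi>I)
      fix x x' y y' assume "x \<in> insert b X" "x' \<in> insert b X" "y \<in> V - insert b X" "y' \<in> V - insert b X" "H x y" "H x' y'"
      then show "H x' y" using thin[of x x' y y'] free by (auto simp: N_def)
    next
      fix x a y c assume "x \<in> insert b X" "a \<in> V - insert b X" "y \<in> V - insert b X" "H x y" "H x c" "H a c"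
      then show "N a \<subseteq> N x" using inv[of x a y c] free by (auto simp: N_def)
    qed
    then show ?thesis using free by blast
  next
    case none
    have "finite (V - X)" "V - X \<noteq> {}" using V X by auto
    then obtain a where a: "a \<in> V - X" "\<And>a'. a' \<in> V - X \<Longrightarrow> card (N a') \<le> card (N a)"
      using finite_ex_max[of "V - X" "\<lambda>u. card (N u)"] by blast
    have "\<Phi> (insert a X)"
    proof (rule \<Phi>I)
      fix x x' y y' assume "x \<in> insert a X" "x' \<in> insert a X" "y \<in> V - insert a X" "y' \<in> V - insert a X" "H x y" "H x' y'"
      then show "H x' y" using none by auto
    next
      fix x c y b assume "x \<in> insert a X" "c \<in> V - insert a X" "y \<in> V - insert a X" "H x y" "H x b" "H c b"
      then show "N c \<subseteq> N x" using none a cmp'[of c b a] by auto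
    qed
    then show ?thesis using a by blast
  next
    case active
    \<comment> \<open>\<open>M\<close> is the common nonzero row of the cut. Its member
      \<open>b\<close> of smallest neighbourhood has unplaced neighbours, as no vertex is free;
      among them the one of largest neighbourhood, \<open>a\<close>, is placed next. The
      neighbourhood of \<open>b\<close> lies in that of every member of \<open>M\<close>, so
      \<open>a\<close> sees all of \<open>M\<close> and its row is \<open>M\<close> again.\<close>
    define M where "M = N x - X"
    have "finite M" "M \<noteq> {}" using finN active by (auto simp: M_def N_def)
    then obtain b where b: "b \<in> M" "\<And>b'. b' \<in> M \<Longrightarrow> card (N b) \<le> card (N b')"
      using finite_ex_min[of M "\<lambda>u. card (N u)"] by blast
    have Hxb: "H x b" and bV: "b \<in> V - X" using b(1) HV Hsym by (auto simp: M_def N_def)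
    have "finite (N b - X)" "N b - X \<noteq> {}" using finN active(4) bV by auto
    then obtain a where a: "a \<in> N b - X" "\<And>a'. a' \<in> N b - X \<Longrightarrow> card (N a') \<le> card (N a)"
      using finite_ex_max[of "N b - X" "\<lambda>u. card (N u)"] by blast
    have Hab: "H a b" and aV: "a \<in> V - X" using a(1) HV Hsym by (auto simp: N_def)
    have Na: "N a \<subseteq> N x" using inv[of x a y b] active aV Hab Hxb by blast
    have Ma: "M \<subseteq> N a"
    proof
      fix b' assume b': "b' \<in> M"
      then have "H x b'" by (auto simp: M_def N_def)
      then have "N b \<subseteq> N b'" using cmp'[of b x b'] b(2)[OF b'] Hsym Hxb by blast
      then show "b' \<in> N a" using a(1) Hsym by (auto simp: N_def)
    qed
    have "a \<notin> M" using no_tri[of x a b] Hab Hxb by (auto simp: M_def N_def)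
    have eqM: "N z - insert a X = M" if "z \<in> insert a X" "H z w" "w \<in> V - insert a X" for z w
    proof (cases "z = a")
      case True
      then show ?thesis using Na Ma \<open>a \<notin> M\<close> by (auto simp: M_def)
    next
      case False
      then have "z \<in> X" "w \<in> V - X" using that by auto
      then have "H z y' \<longleftrightarrow> H x y'" if "y' \<in> V - X" for y'
        using thin[of z x y' y] thin[of x z y' w] active \<open>H z w\<close> that by blast
      then have "N z - X = M"
        using HV Hsym unfolding M_def N_def by blast
      then show ?thesis using \<open>a \<notin> M\<close> by auto
    qed
    have "\<Phi> (insert a X)"
    proof (rule \<Phi>I)
      fix z z' y y' assume "z \<in> insert a X" "z' \<in> insert a X" "y \<in> V - insert a X" "y' \<in> V - insert a X" "H z y" "H z' y'"
      then show "H z' y" using eqM[of z y] eqM[of z' y'] by (auto simp: N_def)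
    next
      fix z c w d assume as: "z \<in> insert a X" "c \<in> V - insert a X" "w \<in> V - insert a X" "H z w" "H z d" "H c d"
      show "N c \<subseteq> N z"
      proof (cases "z = a")
        case True
        show ?thesis
        proof (rule ccontr)
          assume n: "\<not> N c \<subseteq> N z"
          then have "N a \<subseteq> N c" "N c \<noteq> N a" using cmp[of c d a] as True by (auto simp: N_def)
          then have "c \<in> N b - X" using Hab as Hsym by (auto simp: N_def)
          then show False using a(2)[of c] cmp'[of c d a] n as True by auto
        qed
      next
        case False
        then show ?thesis using inv[of z c w d] as by blast
      qed
    qed
    then show ?thesis using aV by blast
  qed
qed

text \<open>\<open>H\<close> is the bipartite complement. In terms of \<open>E\<close>,
  \<open>cA\<close> and \<open>cB\<close> say that two vertices with a common
  \<open>H\<close>-neighbour have comparable \<open>H\<close>-neighbourhoods. The bound counts the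
  two sides as default rows and the single nonzero row \<open>M\<close> of \<open>H\<close>.\<close>

lemma lrw_le_chain_components:
  assumes V: "finite V" "V = A \<union> B" "A \<inter> B = {}"
    and Ein: "\<And>x y. E x y \<Longrightarrow> x \<in> A \<and> y \<in> B \<or> x \<in> B \<and> y \<in> A" and sym: "\<And>x y. E x y \<Longrightarrow> E y x"
    and cA: "\<And>u v w y z. \<lbrakk>u \<in> A; v \<in> A; w \<in> B; y \<in> B; z \<in> B; \<not> E u w; \<not> E v w; E u y; \<not> E v y; E v z; \<not> E u z\<rbrakk> \<Longrightarrow> False"
    and cB: "\<And>u v w y z. \<lbrakk>u \<in> B; v \<in> B; w \<in> A; y \<in> A; z \<in> A; \<not> E u w; \<not> E v w; E u y; \<not> E v y; E v z; \<not> E u z\<rbrakk> \<Longrightarrow> False"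
  shows "lrw_le 3 V E"
proof -
  define H where "H x y \<longleftrightarrow> (x \<in> A \<and> y \<in> B \<or> x \<in> B \<and> y \<in> A) \<and> \<not> E x y" for x y
  define \<Phi> where "\<Phi> X \<longleftrightarrow> (\<forall>x\<in>X. \<forall>x'\<in>X. \<forall>y\<in>V - X. \<forall>y'\<in>V - X. H x y \<longrightarrow> H x' y' \<longrightarrow> H x' y) \<and>
    (\<forall>x\<in>X. \<forall>a\<in>V - X. \<forall>y\<in>V - X. \<forall>b. H x y \<longrightarrow> H x b \<longrightarrow> H a b \<longrightarrow> Collect (H a) \<subseteq> Collect (H x))" for X
  have cmp: "Collect (H u) \<subseteq> Collect (H v) \<or> Collect (H v) \<subseteq> Collect (H u)" if "H u w" "H v w" for u v w
  proof (rule ccontr)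
    assume "\<not> ?thesis"
    then obtain y z where "H u z" "\<not> H v z" "H v y" "\<not> H u y" by blast
    then show False using cA[of u v w y z] cB[of u v w y z] that V(3) unfolding H_def by blast
  qed
  show ?thesis
  proof (rule lrw_leI[OF V(1), where \<Phi> = \<Phi>])
    show "\<Phi> {}" by (simp add: \<Phi>_def)
    show "\<exists>v\<in>V - X. \<Phi> (insert v X)" if "X \<subset> V" "\<Phi> X" for X
      unfolding \<Phi>_def using V
      by (intro chain_components_order[OF V(1) _ _ _ cmp that(1) that(2)[unfolded \<Phi>_def]])
        (use V(3) sym in \<open>auto simp: H_def\<close>)
    show "cut_rank V E X \<le> 3" if X: "X \<subseteq> V" "\<Phi> X" for X
    proof -
      define M where "M = {y \<in> V - X. \<exists>x\<in>X. H x y}"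
      have "cut_rank V E X \<le> card (UNIV :: bool set) + card {M}"
      proof (rule cut_rank_leI[where R = "\<lambda>c y. y \<in> (if c then B else A)"])
        fix x assume x: "x \<in> X"
        have HE: "E x y \<longleftrightarrow> (y \<in> (if x \<in> A then B else A)) \<noteq> H x y" if "y \<in> V" for y
          using V x X(1) Ein[of x y] that by (auto simp: H_def)
        have "\<exists>d\<in>insert {} {M}. \<forall>y\<in>V - X. H x y \<longleftrightarrow> y \<in> d"
        proof (cases "\<exists>y\<in>V - X. H x y")
          case True
          then have "\<forall>y\<in>V - X. H x y \<longleftrightarrow> y \<in> M"
            using X(2) x unfolding \<Phi>_def M_def by blast
          then show ?thesis by blast
        qed blast
        then show "\<exists>c\<in>UNIV. \<exists>d\<in>insert {} {M}. \<forall>y\<in>V - X. E x y \<longleftrightarrow> (y \<in> (if c then B else A)) \<noteq> (y \<in> d)"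
          using HE by (metis DiffD1 UNIV_I)
      qed auto
      then show ?thesis by simp
    qed
  qed
qed


section \<open>Graphs with a five-cycle\<close>

text \<open>A vertex of minimal in-degree is a source.\<close>

lemma multipartite_tournament_source:
  fixes part :: "'a \<Rightarrow> 'c" and P :: "'a \<Rightarrow> 'a \<Rightarrow> bool"
  assumes S: "finite S" "S \<noteq> {}"
    and total: "\<And>u v. u \<in> S \<Longrightarrow> v \<in> S \<Longrightarrow> part u \<noteq> part v \<Longrightarrow> P u v \<or> P v u"
    and asym: "\<And>u v. P u v \<Longrightarrow> \<not> P v u"
    and parts: "\<And>u v. P u v \<Longrightarrow> part u \<noteq> part v"
    and no3: "\<And>x y z. P x y \<Longrightarrow> P y z \<Longrightarrow> P z x \<Longrightarrow> False"
    and no4: "\<And>x y z w. P x y \<Longrightarrow> P y z \<Longrightarrow> P z w \<Longrightarrow> P w x \<Longrightarrow> part x = part z \<Longrightarrow> part y = part w \<Longrightarrow> False"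
  shows "\<exists>s\<in>S. \<forall>u\<in>S. \<not> P u s"
proof -
  define pred where "pred v = {u \<in> S. P u v}" for v
  have "Min ((\<lambda>v. card (pred v)) ` S) \<in> (\<lambda>v. card (pred v)) ` S"
    using S by (intro Min_in) auto
  then obtain s where s: "s \<in> S" "Min ((\<lambda>v. card (pred v)) ` S) = card (pred s)" by blast
  have min: "card (pred s) \<le> card (pred v)" if "v \<in> S" for v
    using S that by (simp flip: s(2))
  have extra: "\<exists>x\<in>pred v. x \<notin> pred s" if "v \<in> S" "u \<in> pred s" "u \<notin> pred v" for u v
  proof (rule ccontr)
    assume "\<not> ?thesis"
    then have "pred v \<subset> pred s" using that by blast
    then have "card (pred v) < card (pred s)" using S by (intro psubset_card_mono) (auto simp: pred_def)
    then show False using min[OF that(1)] by simp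
  qed
  \<comment> \<open>Minimality of \<open>s\<close> yields \<open>x\<close> entering \<open>u\<close>
    but not \<open>s\<close>, and then \<open>y\<close> entering \<open>x\<close> but not
    \<open>s\<close>. The excluded directed triangles put \<open>x\<close> into the part of
    \<open>s\<close> and \<open>y\<close> into the part of \<open>u\<close>, so \<open>s\<close>,
    \<open>y\<close>, \<open>x\<close>, \<open>u\<close> is an excluded four-cycle.\<close>
  have False if u: "u \<in> S" "P u s" for u
  proof -
    have us: "u \<in> pred s" using u by (auto simp: pred_def)
    have "u \<notin> pred u" using asym by (auto simp: pred_def)
    then obtain x where x: "x \<in> S" "P x u" "\<not> P x s"
      using extra[OF u(1) us] by (auto simp: pred_def)
    have px: "part x = part s" using total[of x s] no3[of s x u] x u s by blast
    have "u \<notin> pred x" using asym x by (auto simp: pred_def)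
    then obtain y where y: "y \<in> S" "P y x" "\<not> P y s"
      using extra[OF x(1) us] by (auto simp: pred_def)
    have sy: "P s y" using total[of y s] parts[of y x] px y s by auto
    have "part y = part u" using total[of y u] no3[of y u s] no3[of u y x] sy u x y by blast
    then show False using no4[of s y x u] sy y x u px by simp
  qed
  then show ?thesis using s by blast
qed

section \<open>Vertex classes relative to a five-cycle\<close>

context skew_free
begin

lemma E_comm: "E x y \<longleftrightarrow> E y x"
  using sym by blast

text \<open>A closed walk suffices: in a triangle-free graph a closed walk of length five has no
  chords.\<close>

definition cyc5 :: "'a \<Rightarrow> 'a \<Rightarrow> 'a \<Rightarrow> 'a \<Rightarrow> 'a \<Rightarrow> bool" where
  "cyc5 c0 c1 c2 c3 c4 \<longleftrightarrow> E c0 c1 \<and> E c1 c2 \<and> E c2 c3 \<and> E c3 c4 \<and> E c4 c0"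

lemma c5_rotate: "cyc5 c0 c1 c2 c3 c4 \<Longrightarrow> cyc5 c1 c2 c3 c4 c0"
  by (auto simp: cyc5_def)

lemma c5_reflect: "cyc5 c0 c1 c2 c3 c4 \<Longrightarrow> cyc5 c0 c4 c3 c2 c1"
  by (auto simp: cyc5_def sym)

lemma c5_chords:
  assumes "cyc5 c0 c1 c2 c3 c4"
  shows "\<not> E c0 c2" "\<not> E c0 c3" "\<not> E c1 c3" "\<not> E c1 c4" "\<not> E c2 c4"
    "\<not> E c2 c0" "\<not> E c3 c0" "\<not> E c3 c1" "\<not> E c4 c1" "\<not> E c4 c2"
  using assms tri[of c0 c1 c2] tri[of c1 c2 c3] tri[of c2 c3 c4] tri[of c3 c4 c0] tri[of c4 c0 c1]
  unfolding cyc5_def by (auto simp: E_comm)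

text \<open>In its uses \<open>p\<close> lies on a five-cycle and \<open>q\<close>, \<open>r\<close>
  are the two cycle vertices at distance two from \<open>p\<close>. The cycle neighbours of
  \<open>p\<close> are excluded by triangle-freeness, so \<open>p\<close> is the only neighbour of
  \<open>u\<close> on the cycle.\<close>

definition only :: "'a \<Rightarrow> 'a \<Rightarrow> 'a \<Rightarrow> 'a \<Rightarrow> bool" where
  "only p q r u \<longleftrightarrow> E p u \<and> \<not> E q u \<and> \<not> E r u"

definition both :: "'a \<Rightarrow> 'a \<Rightarrow> 'a \<Rightarrow> bool" where
  "both p q u \<longleftrightarrow> E p u \<and> E q u"

text \<open>If \<open>v\<close> saw \<open>c0\<close>, the subdivided claws at \<open>c0\<close>
  with long legs \<open>v u\<close> and \<open>c1 c2\<close>, or \<open>v u\<close> and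
  \<open>c4 c3\<close>, would make \<open>v\<close> adjacent to both \<open>c2\<close> and
  \<open>c3\<close>. With connectivity it follows that every vertex sees the cycle.\<close>

lemma c5_remote:
  assumes "cyc5 c0 c1 c2 c3 c4" "\<not> E c0 u" "\<not> E c1 u" "\<not> E c2 u" "\<not> E c3 u" "\<not> E c4 u" "E u v"
  shows "\<not> E c0 v"
proof
  assume "E c0 v"
  have "E v c2"
    using skew[of c0 c4 c1 v c2 u] assms \<open>E c0 v\<close> c5_chords[OF assms(1)] unfolding cyc5_def by (auto simp: E_comm)
  moreover have "E v c3"
    using skew[of c0 c1 c4 v c3 u] assms \<open>E c0 v\<close> c5_chords[OF assms(1)] unfolding cyc5_def by (auto simp: E_comm)
  ultimately show False using tri[of v c2 c3] assms(1) unfolding cyc5_def by blast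
qed

text \<open>The class \<open>both c1 c3\<close> has the cycle neighbours of \<open>c2\<close> and
  behaves like \<open>c2\<close> towards vertices attached to \<open>c2\<close> alone. The
  subdivided claw is centred at \<open>c1\<close> with short leg \<open>x\<close>.\<close>

lemma c5_both_only:
  assumes "cyc5 c0 c1 c2 c3 c4" "both c1 c3 x" "only c2 c4 c0 y"
  shows "E x y"
  using skew[of c1 x c0 c2 c4 y] tri[of x c3 c4] assms c5_chords[OF assms(1)] unfolding cyc5_def both_def only_def
  by (auto simp: E_comm)

lemma c5_only_twins:
  assumes "cyc5 c0 c1 c2 c3 c4" "only c0 c2 c3 w" "only c0 c2 c3 w'" "E w y" "\<not> E c4 y" "\<not> E c3 y"
  shows "E w' y"
  using skew[of c0 w' w c4 y c3] assms c5_chords[OF assms(1)] unfolding cyc5_def both_def only_def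
  by (auto simp: E_comm)

lemma c5_triple:
  assumes "cyc5 c0 c1 c2 c3 c4" "only c0 c2 c3 w" "both c1 c3 a" "both c2 c4 b" "\<not> E a b"
  shows "E w a \<or> E w b"
  using skew[of c1 a c0 c2 w b] tri[of b c4 c0] tri[of w c0 c1] assms c5_chords[OF assms(1)]
  unfolding cyc5_def both_def only_def
  by (auto simp: E_comm)

lemma c5_chain_both:
  assumes "cyc5 c0 c1 c2 c3 c4" "both c1 c3 a" "both c1 c3 a'" "both c2 c4 b" "both c2 c4 b'"
    "E a b" "\<not> E a' b" "E a' b'"
  shows "E a b'"
  using skew[of c1 c0 a a' b b'] tri[of b c4 c0] tri[of b' c4 c0] tri[of b c2 b'] assms c5_chords[OF assms(1)]
  unfolding cyc5_def both_def
  by (auto simp: E_comm)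

lemma c5_chain_only:
  assumes "cyc5 c0 c1 c2 c3 c4" "both c1 c3 a" "both c1 c3 a'" "only c0 c2 c3 w" "only c0 c2 c3 w'"
    "E a w" "\<not> E a' w" "E a' w'"
  shows "E a w'"
  using skew[of c3 c4 a a' w w'] tri[of c4 c0 w] tri[of c4 c0 w'] tri[of w c0 w'] assms c5_chords[OF assms(1)]
  unfolding cyc5_def both_def only_def
  by (auto simp: E_comm)

text \<open>The class \<open>both c1 c3\<close> belongs to two triples, one around \<open>c0\<close>
  and one around \<open>c4\<close>, with two kinds of deviation in each. Three of the four
  combinations are excluded here; the fourth is the mirror image of the second.\<close>

lemma c5_one_sided:
  assumes cyc5: "cyc5 c0 c1 c2 c3 c4" and x: "both c1 c3 x"
  shows "both c2 c4 y \<Longrightarrow> \<not> E x y \<Longrightarrow> both c0 c2 z \<Longrightarrow> E x z"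
    and "both c2 c4 y \<Longrightarrow> \<not> E x y \<Longrightarrow> only c4 c1 c2 z \<Longrightarrow> \<not> E x z"
    and "only c0 c2 c3 y \<Longrightarrow> E x y \<Longrightarrow> only c4 c1 c2 z \<Longrightarrow> \<not> E x z"
proof -
  have [simp]: "E c1 x" "E x c1" "E c3 x" "E x c3" using x sym by (auto simp: both_def)
  note ch = c5_chords[OF cyc5] and cyc = cyc5[unfolded cyc5_def]
  {
    assume y: "both c2 c4 y" "\<not> E x y" and z: "both c0 c2 z"
    show "E x z"
    proof (rule ccontr)
      assume "\<not> E x z"
      \<comment> \<open>\<open>y\<close> and \<open>z\<close> take the places of \<open>c3\<close>
        and \<open>c1\<close>. Then \<open>x\<close> misses the whole new cycle although its
        neighbour \<open>c3\<close> sees \<open>c2\<close>.\<close>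
      have "cyc5 c2 y c4 c0 z" using y z cyc unfolding cyc5_def both_def by (auto simp: E_comm)
      then have "\<not> E c2 c3"
        by (rule c5_remote[where u = x])
          (use \<open>\<not> E x z\<close> y cyc tri[of c0 c1 x] tri[of c4 c3 x] tri[of c2 c3 x] in \<open>auto simp: E_comm both_def\<close>)
      then show False using cyc by blast
    qed
  next
    assume y: "both c2 c4 y" "\<not> E x y" and z: "only c4 c1 c2 z"
    show "\<not> E x z"
      using skew[of c1 c0 x c2 z y] tri[of c0 c4 z] tri[of c0 c4 y] tri[of z c4 y] y z cyc ch
      unfolding both_def only_def by (auto simp: E_comm)
  next
    assume y: "only c0 c2 c3 y" "E x y" and z: "only c4 c1 c2 z"
    show "\<not> E x z"
      using skew[of c0 y c1 c4 c2 z] tri[of y x z] y z cyc ch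
      unfolding both_def only_def by (auto simp: E_comm)
  }
qed

text \<open>
  The deviations between the classes \<open>both c1 c3\<close>, \<open>both c2 c4\<close> and \<open>only c0 c2 c3\<close> are the non-edges
  between the first two and the edges from the third to the others. They are the pairs that occur in
  the order second, third, first in the relation \<open>precedes\<close>.
\<close>

definition deviant :: "'a \<Rightarrow> 'a \<Rightarrow> 'a \<Rightarrow> 'a \<Rightarrow> 'a \<Rightarrow> 'a \<Rightarrow> bool" where
  "deviant c0 c1 c2 c3 c4 u \<longleftrightarrow> only c0 c2 c3 u \<or>
    both c1 c3 u \<and> ((\<exists>b. both c2 c4 b \<and> \<not> E u b) \<or> (\<exists>w. only c0 c2 c3 w \<and> E u w)) \<or>
    both c2 c4 u \<and> ((\<exists>a. both c1 c3 a \<and> \<not> E u a) \<or> (\<exists>w. only c0 c2 c3 w \<and> E u w))"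

definition precedes :: "'a \<Rightarrow> 'a \<Rightarrow> 'a \<Rightarrow> 'a \<Rightarrow> 'a \<Rightarrow> 'a \<Rightarrow> 'a \<Rightarrow> bool" where
  "precedes c0 c1 c2 c3 c4 u v \<longleftrightarrow> deviant c0 c1 c2 c3 c4 u \<and> deviant c0 c1 c2 c3 c4 v \<and>
    (both c1 c3 u \<and> both c2 c4 v \<and> E u v \<or> both c2 c4 u \<and> both c1 c3 v \<and> \<not> E u v \<or>
     only c0 c2 c3 u \<and> both c1 c3 v \<and> E u v \<or> both c1 c3 u \<and> only c0 c2 c3 v \<and> \<not> E u v \<or>
     both c2 c4 u \<and> only c0 c2 c3 v \<and> E u v \<or> only c0 c2 c3 u \<and> both c2 c4 v \<and> \<not> E u v)"

lemma c5_disjoint: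
  assumes "cyc5 c0 c1 c2 c3 c4"
  shows "both c1 c3 u \<Longrightarrow> \<not> both c2 c4 u" "only c0 c2 c3 u \<Longrightarrow> \<not> both c1 c3 u" "only c0 c2 c3 u \<Longrightarrow> \<not> both c2 c4 u"
  using assms tri[of c1 c2 u] tri[of c2 c3 u] tri[of c0 c1 u] tri[of c0 c4 u]
  unfolding cyc5_def both_def only_def by (auto simp: E_comm)

text \<open>On deviant vertices \<open>precedes\<close> is a tripartite tournament. A directed
  triangle is a triangle of the graph in one direction and three pairwise non-adjacent vertices in
  the other, which \<open>c5_triple\<close> excludes. A directed four-cycle between two classes
  would be an induced matching of two edges, excluded by \<open>c5_chain_both\<close> and
  \<open>c5_chain_only\<close>.\<close>

lemma precedes_source:
  assumes cyc5: "cyc5 c0 c1 c2 c3 c4" and S: "finite S" "S \<noteq> {}" "\<And>u. u \<in> S \<Longrightarrow> deviant c0 c1 c2 c3 c4 u"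
  shows "\<exists>s\<in>S. \<forall>u\<in>S. \<not> precedes c0 c1 c2 c3 c4 u s"
proof -
  define A where "A = both c1 c3"
  define B where "B = both c2 c4"
  define W where "W = only c0 c2 c3"
  define part where "part u = (if A u then 0 else if B u then 1 else 2 :: nat)" for u
  let ?P = "precedes c0 c1 c2 c3 c4"
  note P = precedes_def[of c0 c1 c2 c3 c4, folded A_def B_def W_def]
  have disj: "A u \<Longrightarrow> \<not> B u" "W u \<Longrightarrow> \<not> A u" "W u \<Longrightarrow> \<not> B u" for u
    using c5_disjoint[OF cyc5] unfolding A_def B_def W_def by blast+
  define T where "T u \<longleftrightarrow> A u \<and> \<not> B u \<and> \<not> W u \<or> \<not> A u \<and> B u \<and> \<not> W u \<or> \<not> A u \<and> \<not> B u \<and> W u" for u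
  have T: "T u" "T v" if "?P u v" for u v
    using that disj unfolding P T_def by blast+
  have same: "A v = A u \<and> B v = B u \<and> W v = W u" if "part u = part v" "T u" "T v" for u v
    using that unfolding part_def T_def by (elim disjE; simp)
  have Q: "A u \<and> B v \<and> E u v \<or> B u \<and> A v \<and> \<not> E u v \<or> W u \<and> A v \<and> E u v \<or> A u \<and> W v \<and> \<not> E u v \<or>
     B u \<and> W v \<and> E u v \<or> W u \<and> B v \<and> \<not> E u v" if "?P u v" for u v
    using that unfolding P by blast
  have triple: "W w \<Longrightarrow> A a \<Longrightarrow> B b \<Longrightarrow> \<not> E a b \<Longrightarrow> E w a \<or> E w b" for w a b
    using c5_triple[OF cyc5] unfolding A_def B_def W_def by blast
  have AB: "E a b'" if "A a" "A a'" "B b" "B b'" "E a b" "\<not> E a' b" "E a' b'" for a a' b b'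
    using c5_chain_both[OF cyc5] that unfolding A_def B_def W_def by blast
  have AW: "E a w'" if "A a" "A a'" "W w" "W w'" "E a w" "\<not> E a' w" "E a' w'" for a a' w w'
    using c5_chain_only[OF cyc5] that unfolding A_def B_def W_def by blast
  have BW: "E b w'" if "B b" "B b'" "W w" "W w'" "E b w" "\<not> E b' w" "E b' w'" for b b' w w'
    using c5_chain_only[OF c5_reflect[OF cyc5], of b b' w w'] that unfolding A_def B_def W_def
    by (auto simp: both_def only_def)
  show ?thesis
  proof (rule multipartite_tournament_source[where part = part])
    fix u v assume uv: "u \<in> S" "v \<in> S" "part u \<noteq> part v"
    have "A u \<or> B u \<or> W u" "A v \<or> B v \<or> W v"
      using S(3) uv unfolding deviant_def A_def B_def W_def by blast+
    then show "?P u v \<or> ?P v u"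
      using uv S(3) unfolding P part_def by (auto simp: E_comm split: if_splits)
  next
    fix u v assume uv: "?P u v"
    then show "\<not> ?P v u" using disj[of u] disj[of v] unfolding P by (auto simp: E_comm)
    show "part u \<noteq> part v" using uv disj[of u] disj[of v] unfolding P part_def by auto
  next
    fix x y z assume xyz: "?P x y" "?P y z" "?P z x"
    have "T x" "T y" "T z"
      using xyz T by blast+
    then show False unfolding T_def
      by (elim disjE; insert Q[OF xyz(1)] Q[OF xyz(2)] Q[OF xyz(3)]
        triple[of x y z] triple[of x z y] triple[of y x z] triple[of y z x]
        triple[of z x y] triple[of z y x] tri[of x y z];
          simp add: E_comm)
  next
    fix x y z w assume xyz: "?P x y" "?P y z" "?P z w" "?P w x" "part x = part z" "part y = part w"
    have T': "T x" "T y"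
      using xyz T by blast+
    have "A z = A x" "B z = B x" "W z = W x" "A w = A y" "B w = B y" "W w = W y"
      using same[OF xyz(5)] same[OF xyz(6)] T[OF xyz(1)] T[OF xyz(3)] by simp_all
    note e = this
    have AB': "?P u v \<Longrightarrow> A u \<Longrightarrow> B v \<Longrightarrow> E u v" "?P v u \<Longrightarrow> A u \<Longrightarrow> B v \<Longrightarrow> \<not> E u v"
      and AW': "?P u v \<Longrightarrow> A u \<Longrightarrow> W v \<Longrightarrow> \<not> E u v" "?P v u \<Longrightarrow> A u \<Longrightarrow> W v \<Longrightarrow> E u v"
      and BW': "?P u v \<Longrightarrow> B u \<Longrightarrow> W v \<Longrightarrow> E u v" "?P v u \<Longrightarrow> B u \<Longrightarrow> W v \<Longrightarrow> \<not> E u v" for u v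
      using Q[of u v] Q[of v u] disj[of u] disj[of v] sym by blast+
    consider "A x" "B y" | "B x" "A y" | "A x" "W y" | "W x" "A y" | "B x" "W y" | "W x" "B y"
      using Q[OF xyz(1)] by blast
    then show False
    proof cases
      case 1 then show False using AB[of x z y w] AB' e xyz(1-4) by blast
    next
      case 2 then show False using AB[of y w z x] AB' e xyz(1-4) by blast
    next
      case 3 then show False using AW[of z x y w] AW' e xyz(1-4) by blast
    next
      case 4 then show False using AW[of w y z x] AW' e xyz(1-4) by blast
    next
      case 5 then show False using BW[of x z y w] BW' e xyz(1-4) by blast
    next
      case 6 then show False using BW[of y w z x] BW' e xyz(1-4) by blast
    qed
  qed (use S in auto)
qed

text \<open>Triples two steps apart have no class in common. Triples one step apart share one class,
  and \<open>c5_one_sided\<close> with its mirror image forbids deviating on both sides. This keeps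
  the five orders independent.\<close>

lemma c5_one_triple:
  assumes cyc5: "cyc5 c0 c1 c2 c3 c4" and u: "deviant c0 c1 c2 c3 c4 u"
  shows "\<not> deviant c1 c2 c3 c4 c0 u" "\<not> deviant c2 c3 c4 c0 c1 u"
proof -
  have key: False if cyc5: "cyc5 c0 c1 c2 c3 c4" and x: "both c1 c3 x" and
    dev: "(\<exists>b. both c2 c4 b \<and> \<not> E x b) \<or> (\<exists>w. only c0 c2 c3 w \<and> E x w)"
    "(\<exists>a. both c0 c2 a \<and> \<not> E x a) \<or> (\<exists>w. only c4 c1 c2 w \<and> E x w)" for c0 c1 c2 c3 c4 x
  proof -
    have x': "both c3 c1 x" using x by (auto simp: both_def)
    have "cyc5 c4 c3 c2 c1 c0" using cyc5 by (auto simp: cyc5_def E_comm)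
    from c5_one_sided[OF this x'] c5_one_sided[OF cyc5 x] show False
      using dev unfolding both_def only_def by blast
  qed
  have n: "\<not> (E c0 u \<and> E c1 u)" "\<not> (E c1 u \<and> E c2 u)" "\<not> (E c2 u \<and> E c3 u)" "\<not> (E c3 u \<and> E c4 u)"
    "\<not> (E c4 u \<and> E c0 u)"
    using cyc5 tri[of c0 c1 u] tri[of c1 c2 u] tri[of c2 c3 u] tri[of c3 c4 u] tri[of c4 c0 u]
    unfolding cyc5_def by blast+
  show "\<not> deviant c1 c2 c3 c4 c0 u"
  proof
    assume t: "deviant c1 c2 c3 c4 c0 u"
    have *: "both c2 c4 u" "\<not> only c0 c2 c3 u" "\<not> both c1 c3 u" "\<not> only c1 c3 c4 u" "\<not> both c3 c0 u"
      using t u n unfolding deviant_def both_def only_def by blast+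
    show False
      using key[OF c5_rotate[OF cyc5] *(1)] *(2-) t u unfolding deviant_def by blast
  qed
  show "\<not> deviant c2 c3 c4 c0 c1 u"
    using u n unfolding deviant_def both_def only_def by blast
qed

lemma precedes_deviant: "precedes c0 c1 c2 c3 c4 u v \<Longrightarrow> deviant c0 c1 c2 c3 c4 u \<and> deviant c0 c1 c2 c3 c4 v"
  by (simp add: precedes_def)

lemma c5_cases:
  assumes cyc5: "cyc5 c0 c1 c2 c3 c4" and "E c0 y \<or> E c1 y \<or> E c2 y \<or> E c3 y \<or> E c4 y"
  obtains "both c1 c3 y" | "both c2 c4 y" | "both c3 c0 y" | "both c4 c1 y" | "both c0 c2 y"
    | "only c0 c2 c3 y" | "only c1 c3 c4 y" | "only c2 c4 c0 y" | "only c3 c0 c1 y" | "only c4 c1 c2 y"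
  using assms tri[of c0 c1 y] tri[of c1 c2 y] tri[of c2 c3 y] tri[of c3 c4 y] tri[of c4 c0 y]
  unfolding cyc5_def both_def only_def by blast

text \<open>The default row is that of \<open>c2\<close>. In the triple around \<open>c0\<close> the
  class of \<open>x\<close> comes last, so all deviations of \<open>x\<close> precede it and none is
  left outside \<open>X\<close>. In the triple around \<open>c4\<close> it comes first: a deviant
  vertex of another class outside \<open>X\<close> does not precede \<open>x\<close>, hence deviates
  from it. So \<open>D\<close> does not depend on \<open>x\<close>.\<close>

lemma c5_both_row:
  assumes cyc5: "cyc5 c0 c1 c2 c3 c4" and x: "both c1 c3 x" "x \<in> X"
    and typed: "\<And>y. y \<in> V \<Longrightarrow> E c0 y \<or> E c1 y \<or> E c2 y \<or> E c3 y \<or> E c4 y"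
    and down: "\<And>x y. x \<in> X \<Longrightarrow> y \<in> V - X \<Longrightarrow> \<not> precedes c0 c1 c2 c3 c4 y x"
      "\<And>x y. x \<in> X \<Longrightarrow> y \<in> V - X \<Longrightarrow> \<not> precedes c4 c0 c1 c2 c3 y x"
  defines "D \<equiv> {y \<in> V - X. deviant c4 c0 c1 c2 c3 y \<and> (both c0 c2 y \<or> only c4 c1 c2 y)}"
  shows "\<exists>d\<in>{{}, D}. \<forall>y\<in>V - X. E x y \<longleftrightarrow> E c2 y \<noteq> (y \<in> d)"
proof -
  note ch = c5_chords[OF cyc5] and cyc = cyc5[unfolded cyc5_def]
  have x': "E c1 x" "E c3 x" "E x c1" "E x c3" using x sym by (auto simp: both_def)
  have diff: "E x y \<noteq> E c2 y \<longleftrightarrow>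
      both c2 c4 y \<and> \<not> E x y \<or> both c0 c2 y \<and> \<not> E x y \<or> only c0 c2 c3 y \<and> E x y \<or> only c4 c1 c2 y \<and> E x y"
    if "y \<in> V" for y
    using cyc5 typed[OF that]
  proof (cases rule: c5_cases)
    case 8
    then show ?thesis using c5_both_only[OF cyc5 x(1)] by (auto simp: both_def only_def)
  qed (use cyc x' ch tri[of x c1 y] tri[of x c3 y] tri[of c1 c2 y] tri[of c2 c3 y] tri[of c3 c4 y] tri[of c0 c1 y]
      in \<open>auto simp: both_def only_def\<close>)
  note one = c5_one_triple(1)[OF c5_rotate[OF c5_rotate[OF c5_rotate[OF c5_rotate[OF cyc5]]]], of x]
  note cmm = E_comm[of x]
  show ?thesis
  proof (cases "deviant c4 c0 c1 c2 c3 x")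
    case True
    then have n: "\<not> deviant c0 c1 c2 c3 c4 x" using one by blast
    have "E x y \<noteq> E c2 y \<longleftrightarrow> y \<in> D" if y: "y \<in> V - X" for y
    proof
      assume "E x y \<noteq> E c2 y"
      then have *: "both c0 c2 y \<and> \<not> E x y \<or> only c4 c1 c2 y \<and> E x y"
        using diff[of y] y n x(1) unfolding deviant_def by blast
      then have "deviant c4 c0 c1 c2 c3 y"
        unfolding deviant_def using x(1) cmm by blast
      then show "y \<in> D"
        using * y unfolding D_def by blast
    next
      assume yD: "y \<in> D"
      then have "\<not> precedes c4 c0 c1 c2 c3 y x" using down(2) x(2) y by blast
      then have "both c0 c2 y \<and> \<not> E x y \<or> only c4 c1 c2 y \<and> E x y"
        using yD True x(1) cmm unfolding precedes_def D_def by blast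
      then show "E x y \<noteq> E c2 y" using diff[of y] y by blast
    qed
    then show ?thesis by blast
  next
    case False
    have "E x y = E c2 y" if y: "y \<in> V - X" for y
    proof (rule ccontr)
      assume "E x y \<noteq> E c2 y"
      then have d: "both c2 c4 y \<and> \<not> E x y \<or> only c0 c2 c3 y \<and> E x y"
        using diff[of y] y False x(1) unfolding deviant_def by blast
      then have "deviant c0 c1 c2 c3 c4 y" "deviant c0 c1 c2 c3 c4 x"
        unfolding deviant_def using x(1) cmm by blast+
      then have "precedes c0 c1 c2 c3 c4 y x"
        using d x(1) cmm unfolding precedes_def by blast
      then show False using down(1) x(2) y by blast
    qed
    then show ?thesis by blast
  qed
qed

text \<open>In its triple \<open>w\<close> comes between the two other classes: deviations towards
  \<open>both c2 c4\<close> precede it and are gone, those towards \<open>both c1 c3\<close> are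
  exactly \<open>D\<close>. By \<open>c5_only_twins\<close> the whole class of \<open>w\<close> has
  the same neighbours attached to \<open>c1\<close> or \<open>c4\<close> alone; the existential in
  \<open>R\<close> therefore makes \<open>R\<close> independent of \<open>w\<close>.\<close>

lemma c5_only_row:
  assumes cyc5: "cyc5 c0 c1 c2 c3 c4" and w: "only c0 c2 c3 w" "w \<in> X"
    and typed: "\<And>y. y \<in> V \<Longrightarrow> E c0 y \<or> E c1 y \<or> E c2 y \<or> E c3 y \<or> E c4 y"
    and down: "\<And>x y. x \<in> X \<Longrightarrow> y \<in> V - X \<Longrightarrow> \<not> precedes c0 c1 c2 c3 c4 y x"
  defines "D \<equiv> {y \<in> V - X. deviant c0 c1 c2 c3 c4 y \<and> both c1 c3 y}"
    and "R \<equiv> {y. both c4 c1 y \<or> (only c1 c3 c4 y \<or> only c4 c1 c2 y) \<and> (\<exists>w. only c0 c2 c3 w \<and> E w y)}"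
  shows "\<forall>y\<in>V - X. E w y \<longleftrightarrow> (y \<in> R) \<noteq> (y \<in> D)"
proof
  fix y assume y: "y \<in> V - X"
  note ch = c5_chords[OF cyc5] and cyc = cyc5[unfolded cyc5_def]
  have w': "E c0 w" "E w c0" "\<not> E c2 w" "\<not> E c3 w" "\<not> E w c2" "\<not> E w c3"
    using w sym by (auto simp: only_def)
  have "deviant c0 c1 c2 c3 c4 w" using w by (simp add: deviant_def)
  then have before: "both c1 c3 y \<Longrightarrow> deviant c0 c1 c2 c3 c4 y \<Longrightarrow> E w y"
    "both c2 c4 y \<Longrightarrow> deviant c0 c1 c2 c3 c4 y \<Longrightarrow> \<not> E w y"
    using down[OF w(2) y] w(1) E_comm[of w y] unfolding precedes_def by blast+
  have deviant: "E w y \<Longrightarrow> both c1 c3 y \<or> both c2 c4 y \<Longrightarrow> deviant c0 c1 c2 c3 c4 y"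
    using w(1) E_comm[of w y] unfolding deviant_def by blast
  note t = tri[of w c0 y] tri[of c0 c1 y] tri[of c1 c2 y] tri[of c2 c3 y] tri[of c3 c4 y] tri[of c4 c0 y]
  note c5a = c5_rotate[OF c5_rotate[OF c5_rotate[OF cyc5]]]
  have "y \<in> V" using y by blast
  from cyc5 typed[OF this] show "E w y \<longleftrightarrow> (y \<in> R) \<noteq> (y \<in> D)"
  proof (cases rule: c5_cases)
    case 1 then show ?thesis using before deviant y t cyc by (auto simp: R_def D_def both_def only_def)
  next
    case 2 then show ?thesis using before deviant y t cyc by (auto simp: R_def D_def both_def only_def)
  next
    case 3 then show ?thesis using y t cyc w' by (auto simp: R_def D_def both_def only_def)
  next
    case 4 
    then have "E y w" using c5_both_only[OF c5a _ w(1)] by blast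
    then show ?thesis using 4 t cyc w' E_comm[of w y] by (auto simp: R_def D_def both_def only_def)
  next
    case 5 then show ?thesis using y t cyc w' by (auto simp: R_def D_def both_def only_def)
  next
    case 6 then show ?thesis using y t cyc w' by (auto simp: R_def D_def both_def only_def)
  next
    case 7
    have "E w y" if "E w0 y" "only c0 c2 c3 w0" for w0
      using c5_only_twins[OF cyc5 that(2) w(1) that(1)] 7 t cyc unfolding only_def by blast
    then show ?thesis using 7 t cyc w by (auto simp: R_def D_def both_def only_def)
  next
    case 8
    have "\<not> E w y" using skew[of c0 c1 w c4 y c3] 8 t cyc ch w' by (auto simp: only_def E_comm)
    then show ?thesis using 8 t cyc w' by (auto simp: R_def D_def both_def only_def)
  next
    case 9
    have "\<not> E w y" using skew[of c0 c4 w c1 y c2] 9 t cyc ch w' by (auto simp: only_def E_comm)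
    then show ?thesis using 9 t cyc w' by (auto simp: R_def D_def both_def only_def)
  next
    case 10
    have "only c0 c3 c2 w0" if "only c0 c2 c3 w0" for w0 using that by (auto simp: only_def)
    then have "E w y" if "E w0 y" "only c0 c2 c3 w0" for w0
      using c5_only_twins[OF c5_reflect[OF cyc5], of w0 w y] that w(1) 10 t cyc unfolding only_def by blast
    then show ?thesis using 10 t cyc w by (auto simp: R_def D_def both_def only_def)
  qed
qed

end

section \<open>One ordering for all five triples in a connected graph\<close>

locale connected_skew_free = skew_free +
  assumes conn: "T \<subset> V \<Longrightarrow> T \<noteq> {} \<Longrightarrow> \<exists>x\<in>T. \<exists>y\<in>V - T. E x y"
begin

lemma connected_induct:
  assumes c: "c \<in> V" "P c" and step: "\<And>u v. E u v \<Longrightarrow> P v \<Longrightarrow> P u" and u: "u \<in> V"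
  shows "P u"
proof (rule ccontr)
  assume "\<not> P u"
  then have "{u \<in> V. \<not> P u} \<subset> V" "{u \<in> V. \<not> P u} \<noteq> {}" using c u by blast+
  from conn[OF this] show False using step by blast
qed

lemma c5_typed:
  assumes c5: "cyc5 c0 c1 c2 c3 c4" and "y \<in> V"
  shows "E c0 y \<or> E c1 y \<or> E c2 y \<or> E c3 y \<or> E c4 y"
proof (rule connected_induct[OF _ _ _ assms(2), where P = "\<lambda>y. E c0 y \<or> E c1 y \<or> E c2 y \<or> E c3 y \<or> E c4 y"])
  show "c0 \<in> V" "E c0 c0 \<or> E c1 c0 \<or> E c2 c0 \<or> E c3 c0 \<or> E c4 c0"
    using c5 E_in by (auto simp: cyc5_def)
  show "E c0 u \<or> E c1 u \<or> E c2 u \<or> E c3 u \<or> E c4 u"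
    if uv: "E u v" "E c0 v \<or> E c1 v \<or> E c2 v \<or> E c3 v \<or> E c4 v" for u v
  proof (rule ccontr)
    assume "\<not> ?thesis"
    then have u: "\<not> E c0 u" "\<not> E c1 u" "\<not> E c2 u" "\<not> E c3 u" "\<not> E c4 u" by auto
    note r = c5_rotate
    show False
      using c5_remote[OF c5 u uv(1)] c5_remote[OF r[OF c5] u(2-5) u(1) uv(1)]
        c5_remote[OF r[OF r[OF c5]] u(3-5) u(1-2) uv(1)]
        c5_remote[OF r[OF r[OF r[OF c5]]] u(4-5) u(1-3) uv(1)]
        c5_remote[OF r[OF r[OF r[OF r[OF c5]]]] u(5) u(1-4) uv(1)] uv(2)
      by blast
  qed
qed

text \<open>The prefixes are the sets closed under predecessors in all five triples. Default rows
  are the five cycle vertices, for the \<open>both\<close> classes, and five sets \<open>Ro\<close>,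
  for the \<open>only\<close> classes; the deviation sets are five \<open>Db\<close> and five
  \<open>Do\<close>.\<close>

lemma lrw_le_c5:
  assumes cyc5: "cyc5 c0 c1 c2 c3 c4"
  shows "lrw_le 20 V E"
proof -
  note r0 = cyc5 and r1 = c5_rotate[OF cyc5]
  note r2 = c5_rotate[OF r1]
  note r3 = c5_rotate[OF r2]
  note r4 = c5_rotate[OF r3]
  define P where "P u v \<longleftrightarrow> precedes c0 c1 c2 c3 c4 u v \<or> precedes c1 c2 c3 c4 c0 u v \<or> precedes c2 c3 c4 c0 c1 u v \<or>
    precedes c3 c4 c0 c1 c2 u v \<or> precedes c4 c0 c1 c2 c3 u v" for u v
  define \<Phi> where "\<Phi> X \<longleftrightarrow> (\<forall>x\<in>X. \<forall>y\<in>V - X. \<not> P y x)" for X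
  have one: "deviant c0 c1 c2 c3 c4 u \<Longrightarrow> \<not> deviant c1 c2 c3 c4 c0 u \<and> \<not> deviant c2 c3 c4 c0 c1 u \<and> \<not> deviant c3 c4 c0 c1 c2 u \<and> \<not> deviant c4 c0 c1 c2 c3 u"
    "deviant c1 c2 c3 c4 c0 u \<Longrightarrow> \<not> deviant c2 c3 c4 c0 c1 u \<and> \<not> deviant c3 c4 c0 c1 c2 u \<and> \<not> deviant c4 c0 c1 c2 c3 u"
    "deviant c2 c3 c4 c0 c1 u \<Longrightarrow> \<not> deviant c3 c4 c0 c1 c2 u \<and> \<not> deviant c4 c0 c1 c2 c3 u"
    "deviant c3 c4 c0 c1 c2 u \<Longrightarrow> \<not> deviant c4 c0 c1 c2 c3 u" for u
    using c5_one_triple[OF r0, of u] c5_one_triple[OF r1, of u] c5_one_triple[OF r2, of u]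
      c5_one_triple[OF r3, of u] c5_one_triple[OF r4, of u] by blast+
  \<comment> \<open>No vertex is deviant in two triples, so a \<open>P\<close>-predecessor of
    \<open>u\<close> precedes it in the triple of \<open>u\<close>. Hence a source among the
    vertices of \<open>S\<close> deviant in a single triple is a source of all of
    \<open>S\<close>.\<close>
  have sel: "(deviant c0 c1 c2 c3 c4 u \<longrightarrow> precedes c0 c1 c2 c3 c4 y u) \<and> (deviant c1 c2 c3 c4 c0 u \<longrightarrow> precedes c1 c2 c3 c4 c0 y u) \<and>
      (deviant c2 c3 c4 c0 c1 u \<longrightarrow> precedes c2 c3 c4 c0 c1 y u) \<and> (deviant c3 c4 c0 c1 c2 u \<longrightarrow> precedes c3 c4 c0 c1 c2 y u) \<and>
      (deviant c4 c0 c1 c2 c3 u \<longrightarrow> precedes c4 c0 c1 c2 c3 y u)" if "P y u" for u y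
    using that one[of u] precedes_deviant[of c0 c1 c2 c3 c4 y u] precedes_deviant[of c1 c2 c3 c4 c0 y u] precedes_deviant[of c2 c3 c4 c0 c1 y u]
      precedes_deviant[of c3 c4 c0 c1 c2 y u] precedes_deviant[of c4 c0 c1 c2 c3 y u]
    unfolding P_def by argo
  have source: "\<exists>s\<in>S. \<forall>y\<in>S. \<not> P y s" if S: "S \<subseteq> V" "S \<noteq> {}" for S
  proof -
    have fin: "finite {u \<in> S. Q u}" for Q by (rule finite_subset[OF _ finV]) (use S(1) in blast)
    have src: "\<exists>s\<in>S. \<forall>y\<in>S. \<not> P y s" 
      if c: "cyc5 d0 d1 d2 d3 d4" and ex: "\<exists>u\<in>S. deviant d0 d1 d2 d3 d4 u"
        and P: "\<And>u y. P y u \<Longrightarrow> deviant d0 d1 d2 d3 d4 u \<Longrightarrow> precedes d0 d1 d2 d3 d4 y u" for d0 d1 d2 d3 d4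
    proof -
      have "{u \<in> S. deviant d0 d1 d2 d3 d4 u} \<noteq> {}" using ex by blast
      from precedes_source[OF c fin this] obtain s where s: "s \<in> S" "deviant d0 d1 d2 d3 d4 s"
        "\<And>y. y \<in> S \<Longrightarrow> deviant d0 d1 d2 d3 d4 y \<Longrightarrow> \<not> precedes d0 d1 d2 d3 d4 y s" by auto
      have "\<not> P y s" if "y \<in> S" for y
        using s(3)[OF that] precedes_deviant[of d0 d1 d2 d3 d4 y s] P[of y s] s(2) by blast
      then show ?thesis using s(1) by blast
    qed
    consider "\<exists>u\<in>S. deviant c0 c1 c2 c3 c4 u" | "\<exists>u\<in>S. deviant c1 c2 c3 c4 c0 u" | "\<exists>u\<in>S. deviant c2 c3 c4 c0 c1 u"
      | "\<exists>u\<in>S. deviant c3 c4 c0 c1 c2 u" | "\<exists>u\<in>S. deviant c4 c0 c1 c2 c3 u"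
      | "\<And>u y. u \<in> S \<Longrightarrow> \<not> P y u"
      unfolding P_def using precedes_deviant by blast
    then show ?thesis
    proof cases
      case 1 show ?thesis by (rule src[OF r0 1]) (use sel in simp)
    next
      case 2 show ?thesis by (rule src[OF r1 2]) (use sel in simp)
    next
      case 3 show ?thesis by (rule src[OF r2 3]) (use sel in simp)
    next
      case 4 show ?thesis by (rule src[OF r3 4]) (use sel in simp)
    next
      case 5 show ?thesis by (rule src[OF r4 5]) (use sel in simp)
    next
      case 6 then show ?thesis using S by blast
    qed
  qed
  show ?thesis
  proof (rule lrw_leI[OF finV, where \<Phi> = \<Phi>])
    show "\<Phi> {}" by (simp add: \<Phi>_def)
    show "\<exists>v\<in>V - X. \<Phi> (insert v X)" if "X \<subset> V" "\<Phi> X" for X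
    proof -
      have "V - X \<subseteq> V" "V - X \<noteq> {}" using that by blast+
      from source[OF this] show ?thesis using that(2) unfolding \<Phi>_def by blast
    qed
    show "cut_rank V E X \<le> 20" if X: "X \<subseteq> V" "\<Phi> X" for X
    proof -
      have down: "\<And>x y. x \<in> X \<Longrightarrow> y \<in> V - X \<Longrightarrow> \<not> precedes c0 c1 c2 c3 c4 y x"
        "\<And>x y. x \<in> X \<Longrightarrow> y \<in> V - X \<Longrightarrow> \<not> precedes c1 c2 c3 c4 c0 y x"
        "\<And>x y. x \<in> X \<Longrightarrow> y \<in> V - X \<Longrightarrow> \<not> precedes c2 c3 c4 c0 c1 y x"
        "\<And>x y. x \<in> X \<Longrightarrow> y \<in> V - X \<Longrightarrow> \<not> precedes c3 c4 c0 c1 c2 y x"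
        "\<And>x y. x \<in> X \<Longrightarrow> y \<in> V - X \<Longrightarrow> \<not> precedes c4 c0 c1 c2 c3 y x"
        using X(2) unfolding \<Phi>_def P_def by blast+
      define Db where "Db d0 d1 d2 d3 d4 = {y \<in> V - X. deviant d4 d0 d1 d2 d3 y \<and> (both d0 d2 y \<or> only d4 d1 d2 y)}" for d0 d1 d2 d3 d4
      define Do where "Do d0 d1 d2 d3 d4 = {y \<in> V - X. deviant d0 d1 d2 d3 d4 y \<and> both d1 d3 y}" for d0 d1 d2 d3 d4
      define Ro where "Ro d0 d1 d2 d3 d4 = {y. both d4 d1 y \<or> (only d1 d3 d4 y \<or> only d4 d1 d2 y) \<and> (\<exists>w. only d0 d2 d3 w \<and> E w y)}" for d0 d1 d2 d3 d4
      define Cl where "Cl = map (\<lambda>c. Collect (E c)) [c0, c1, c2, c3, c4] @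
        [Ro c0 c1 c2 c3 c4, Ro c1 c2 c3 c4 c0, Ro c2 c3 c4 c0 c1, Ro c3 c4 c0 c1 c2, Ro c4 c0 c1 c2 c3]"
      define Dl where "Dl = [Db c0 c1 c2 c3 c4, Db c1 c2 c3 c4 c0, Db c2 c3 c4 c0 c1, Db c3 c4 c0 c1 c2, Db c4 c0 c1 c2 c3,
        Do c0 c1 c2 c3 c4, Do c1 c2 c3 c4 c0, Do c2 c3 c4 c0 c1, Do c3 c4 c0 c1 c2, Do c4 c0 c1 c2 c3]"
      have "cut_rank V E X \<le> card (set Cl) + card (set Dl)"
      proof (rule cut_rank_leI[where R = "\<lambda>c y. y \<in> c"])
        fix x assume x: "x \<in> X"
        let ?row = "\<exists>c\<in>set Cl. \<exists>d\<in>insert {} (set Dl). \<forall>y\<in>V - X. E x y \<longleftrightarrow> (y \<in> c) \<noteq> (y \<in> d)"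
        have b: ?row if c: "cyc5 d0 d1 d2 d3 d4" "both d1 d3 x" and m: "Collect (E d2) \<in> set Cl" "Db d0 d1 d2 d3 d4 \<in> set Dl"
          and d: "\<And>x y. x \<in> X \<Longrightarrow> y \<in> V - X \<Longrightarrow> \<not> precedes d0 d1 d2 d3 d4 y x"
          "\<And>x y. x \<in> X \<Longrightarrow> y \<in> V - X \<Longrightarrow> \<not> precedes d4 d0 d1 d2 d3 y x" for d0 d1 d2 d3 d4
        proof -
          obtain d' where "d' \<in> {{}, Db d0 d1 d2 d3 d4}" "\<forall>y\<in>V - X. E x y \<longleftrightarrow> E d2 y \<noteq> (y \<in> d')"
            using c5_both_row[OF c x c5_typed[OF c(1)] d, folded Db_def] by blast
          then show ?thesis
            using m by (intro bexI[OF _ m(1)] bexI[of _ d']) auto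
        qed
        have o: ?row if c: "cyc5 d0 d1 d2 d3 d4" "only d0 d2 d3 x" and m: "Ro d0 d1 d2 d3 d4 \<in> set Cl" "Do d0 d1 d2 d3 d4 \<in> set Dl"
          and d: "\<And>x y. x \<in> X \<Longrightarrow> y \<in> V - X \<Longrightarrow> \<not> precedes d0 d1 d2 d3 d4 y x" for d0 d1 d2 d3 d4
          using c5_only_row[OF c x c5_typed[OF c(1)] d, folded Do_def Ro_def] m by blast
        have "x \<in> V" using x X by blast
        from cyc5 c5_typed[OF cyc5 this] show ?row
        proof (cases rule: c5_cases)
          case 1 show ?thesis by (rule b[OF r0 1 _ _ down(1,5)]) (simp_all add: Cl_def Dl_def)
        next
          case 2 show ?thesis by (rule b[OF r1 2 _ _ down(2,1)]) (simp_all add: Cl_def Dl_def)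
        next
          case 3 show ?thesis by (rule b[OF r2 3 _ _ down(3,2)]) (simp_all add: Cl_def Dl_def)
        next
          case 4 show ?thesis by (rule b[OF r3 4 _ _ down(4,3)]) (simp_all add: Cl_def Dl_def)
        next
          case 5 show ?thesis by (rule b[OF r4 5 _ _ down(5,4)]) (simp_all add: Cl_def Dl_def)
        next
          case 6 show ?thesis by (rule o[OF r0 6 _ _ down(1)]) (simp_all add: Cl_def Dl_def)
        next
          case 7 show ?thesis by (rule o[OF r1 7 _ _ down(2)]) (simp_all add: Cl_def Dl_def)
        next
          case 8 show ?thesis by (rule o[OF r2 8 _ _ down(3)]) (simp_all add: Cl_def Dl_def)
        next
          case 9 show ?thesis by (rule o[OF r3 9 _ _ down(4)]) (simp_all add: Cl_def Dl_def)
        next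
          case 10 show ?thesis by (rule o[OF r4 10 _ _ down(5)]) (simp_all add: Cl_def Dl_def)
        qed
      qed auto
      also have "\<dots> \<le> length Cl + length Dl"
        by (intro add_mono card_length)
      finally show ?thesis by (simp add: Cl_def Dl_def)
    qed
  qed
qed

end

section \<open>Graphs without a five-cycle\<close>

locale c5_free = connected_skew_free +
  assumes no5: "E a b \<Longrightarrow> E b c \<Longrightarrow> E c d \<Longrightarrow> E d e \<Longrightarrow> E e a \<Longrightarrow> False"
begin

text \<open>One side suffices. For a violation on the side \<open>A\<close>, connectivity gives
  \<open>w\<close> a neighbour \<open>a\<close>. If \<open>a\<close> saw both \<open>y\<close> and
  \<open>z\<close>, it would be the centre of a subdivided claw; otherwise \<open>w\<close> and the
  one it misses form a violation on the side \<open>B\<close>.\<close>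

lemma lrw_le_bipartite:
  assumes V: "V = A \<union> B" "A \<inter> B = {}"
    and indep: "\<And>x y. x \<in> A \<Longrightarrow> y \<in> A \<Longrightarrow> \<not> E x y" "\<And>x y. x \<in> B \<Longrightarrow> y \<in> B \<Longrightarrow> \<not> E x y"
    and cB: "\<And>u v w y z. \<lbrakk>u \<in> B; v \<in> B; w \<in> A; y \<in> A; z \<in> A; \<not> E u w; \<not> E v w; E u y; \<not> E v y; E v z; \<not> E u z\<rbrakk> \<Longrightarrow> False"
  shows "lrw_le 3 V E"
proof (rule lrw_le_chain_components[OF finV V])
  show across: "x \<in> A \<and> y \<in> B \<or> x \<in> B \<and> y \<in> A" if "E x y" for x y
    using that E_in[OF that] E_in[OF sym[OF that]] V indep by blast
  fix u v w y z
  assume uv: "u \<in> A" "v \<in> A" and wyz: "w \<in> B" "y \<in> B" "z \<in> B"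
    and n: "\<not> E u w" "\<not> E v w" "E u y" "\<not> E v y" "E v z" "\<not> E u z"
  have "{w} \<subset> V" "{w} \<noteq> {}" using uv wyz V by auto
  then obtain a where a: "E w a" using conn[of "{w}"] by blast
  then have "a \<in> A" using across wyz indep by blast
  have "\<not> E a y \<or> \<not> E a z"
    using skew[of a w y z u v] a n indep(1)[OF uv] by (auto simp: E_comm)
  then show False
  proof
    assume "\<not> E a y"
    then show False
      using cB[of w y v a u] uv wyz n \<open>a \<in> A\<close> a by (auto simp: E_comm)
  next
    assume "\<not> E a z"
    then show False
      using cB[of w z u a v] uv wyz n \<open>a \<in> A\<close> a by (auto simp: E_comm)
  qed
qed (use sym cB in blast)+

text \<open>The sides are the neighbours of \<open>b\<close> and all other vertices; an edge among
  the latter would close a five-cycle. A violation of \<open>cB\<close> is a subdivided claw with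
  centre \<open>b\<close>, short leg \<open>w\<close> and long legs \<open>y u\<close> and
  \<open>z v\<close>.\<close>

lemma lrw_le_dominating:
  assumes dist: "\<And>u. u \<in> V \<Longrightarrow> u = b \<or> E b u \<or> (\<exists>a. E b a \<and> E a u)"
  shows "lrw_le 3 V E"
proof (rule lrw_le_bipartite[of "{u \<in> V. E b u}" "{u \<in> V. \<not> E b u}"])
  show "\<not> E x y" if "x \<in> {u \<in> V. E b u}" "y \<in> {u \<in> V. E b u}" for x y
    using that tri[of b x y] by auto
  show B: "\<not> E x y" if m: "x \<in> {u \<in> V. \<not> E b u}" "y \<in> {u \<in> V. \<not> E b u}" for x y
  proof
    assume xy: "E x y"
    have "x \<noteq> b" "y \<noteq> b" using m xy by (auto simp: E_comm)
    then obtain a c where "E b a" "E a x" "E b c" "E c y" using dist[of x] dist[of y] m by blast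
    then show False using no5[of b a x y c] xy sym by blast
  qed
  fix u v w y z
  assume *: "u \<in> {u \<in> V. \<not> E b u}" "v \<in> {u \<in> V. \<not> E b u}"
    and "w \<in> {u \<in> V. E b u}" "y \<in> {u \<in> V. E b u}" "z \<in> {u \<in> V. E b u}"
    "\<not> E u w" "\<not> E v w" "E u y" "\<not> E v y" "E v z" "\<not> E u z"
  then show False using skew[of b w y z u v] B[OF *] by (auto simp: E_comm)
qed auto

section \<open>Closed walks of length six and seven\<close>

definition cyc6 :: "'a \<Rightarrow> 'a \<Rightarrow> 'a \<Rightarrow> 'a \<Rightarrow> 'a \<Rightarrow> 'a \<Rightarrow> bool" where
  "cyc6 c0 c1 c2 c3 c4 c5 \<longleftrightarrow> E c0 c1 \<and> E c1 c2 \<and> E c2 c3 \<and> E c3 c4 \<and> E c4 c5 \<and> E c5 c0 \<and>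
    \<not> E c0 c3 \<and> \<not> E c1 c4 \<and> \<not> E c2 c5"

lemma c6_rotate: "cyc6 c0 c1 c2 c3 c4 c5 \<Longrightarrow> cyc6 c1 c2 c3 c4 c5 c0"
  by (auto simp: cyc6_def E_comm)

lemma c6_chords:
  assumes "cyc6 c0 c1 c2 c3 c4 c5"
  shows "\<not> E c0 c2" "\<not> E c1 c3" "\<not> E c2 c4" "\<not> E c3 c5" "\<not> E c0 c4" "\<not> E c1 c5"
  using assms tri[of c0 c1 c2] tri[of c1 c2 c3] tri[of c2 c3 c4] tri[of c3 c4 c5] tri[of c4 c5 c0] tri[of c5 c0 c1]
  unfolding cyc6_def by (auto simp: E_comm)

text \<open>The second neighbour comes from the subdivided claw at \<open>c0\<close> with short leg
  \<open>u\<close> and long legs along the cycle. A neighbour at odd distance would close a triangle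
  or a five-cycle.\<close>

lemma c6_nbr:
  assumes "cyc6 c0 c1 c2 c3 c4 c5" "E c0 u"
  shows "E c2 u \<or> E c4 u" "\<not> E c1 u" "\<not> E c3 u" "\<not> E c5 u"
  using skew[of c0 u c1 c5 c2 c4] tri[of c0 c1 u] tri[of c5 c0 u] no5[of u c0 c1 c2 c3]
    assms c6_chords[OF assms(1)]
  unfolding cyc6_def by (auto simp: E_comm)

text \<open>If \<open>v\<close> sees just two of \<open>c0\<close>, \<open>c2\<close>,
  \<open>c4\<close>, it replaces the cycle vertex between them, and \<open>c6_nbr\<close> gives its
  neighbour \<open>u\<close> a further neighbour on the new cycle. If \<open>v\<close> sees all
  three, \<open>v\<close> is itself the centre of a subdivided claw.\<close>

lemma c6_remote:
  assumes cyc6: "cyc6 c0 c1 c2 c3 c4 c5"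
    and u: "\<not> E c0 u" "\<not> E c1 u" "\<not> E c2 u" "\<not> E c3 u" "\<not> E c4 u" "\<not> E c5 u" "E u v"
  shows "\<not> E c0 v"
proof
  assume v: "E c0 v"
  note cycle_adj = c6_nbr[OF cyc6 v]
  note cyc = cyc6[unfolded cyc6_def] and ch = c6_chords[OF cyc6]
  consider "E c2 v" "E c4 v" | "E c2 v" "\<not> E c4 v" | "\<not> E c2 v" "E c4 v" using cycle_adj(1) by blast
  then show False
  proof cases
    case 1
    then show ?thesis using skew[of v u c4 c2 c5 c1] u cyc ch by (auto simp: E_comm)
  next
    case 2
    then have "cyc6 v c2 c3 c4 c5 c0" using cyc cycle_adj v by (auto simp: cyc6_def E_comm)
    then show ?thesis using c6_nbr(1)[of v c2 c3 c4 c5 c0 u] u by (auto simp: E_comm)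
  next
    case 3
    then have "cyc6 v c0 c1 c2 c3 c4" using cyc cycle_adj v by (auto simp: cyc6_def E_comm)
    then show ?thesis using c6_nbr(1)[of v c0 c1 c2 c3 c4 u] u by (auto simp: E_comm)
  qed
qed

lemma lrw_le_c6:
  assumes cyc6: "cyc6 c0 c1 c2 c3 c4 c5"
  shows "lrw_le 3 V E"
proof -
  note r0 = cyc6 and r1 = c6_rotate[OF cyc6]
  note r2 = c6_rotate[OF r1]
  note r3 = c6_rotate[OF r2]
  note r4 = c6_rotate[OF r3]
  note r5 = c6_rotate[OF r4]
  note cyc = cyc6[unfolded cyc6_def] and ch = c6_chords[OF cyc6]
  define A where "A = {u. E c1 u \<or> E c3 u \<or> E c5 u}"
  define B where "B = {u. E c0 u \<or> E c2 u \<or> E c4 u}"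
  have A2: "(E c1 u \<and> E c3 u \<or> E c3 u \<and> E c5 u \<or> E c5 u \<and> E c1 u) \<and> \<not> E c0 u \<and> \<not> E c2 u \<and> \<not> E c4 u" if "u \<in> A" for u
    using that c6_nbr[OF r1, of u] c6_nbr[OF r3, of u] c6_nbr[OF r5, of u] unfolding A_def by blast
  have B2: "(E c0 u \<and> E c2 u \<or> E c2 u \<and> E c4 u \<or> E c4 u \<and> E c0 u) \<and> \<not> E c1 u \<and> \<not> E c3 u \<and> \<not> E c5 u" if "u \<in> B" for u
    using that c6_nbr[OF r0, of u] c6_nbr[OF r2, of u] c6_nbr[OF r4, of u] unfolding B_def by blast
  have "u \<in> A \<union> B" if "u \<in> V" for u
  proof (rule connected_induct[OF _ _ _ that, where P = "\<lambda>u. u \<in> A \<union> B"])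
    show "c0 \<in> V" "c0 \<in> A \<union> B" using cyc E_in sym by (auto simp: A_def)
    show "u \<in> A \<union> B" if uv: "E u v" "v \<in> A \<union> B" for u v
    proof (rule ccontr)
      assume "u \<notin> A \<union> B"
      then have u: "\<not> E c0 u" "\<not> E c1 u" "\<not> E c2 u" "\<not> E c3 u" "\<not> E c4 u" "\<not> E c5 u"
        by (auto simp: A_def B_def)
      then show False
        using c6_remote[OF r0 _ _ _ _ _ _ uv(1)] c6_remote[OF r1 _ _ _ _ _ _ uv(1)]
          c6_remote[OF r2 _ _ _ _ _ _ uv(1)] c6_remote[OF r3 _ _ _ _ _ _ uv(1)]
          c6_remote[OF r4 _ _ _ _ _ _ uv(1)] c6_remote[OF r5 _ _ _ _ _ _ uv(1)] uv(2)
        unfolding A_def B_def by blast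
    qed
  qed
  moreover have "A \<union> B \<subseteq> V" using E_in sym unfolding A_def B_def by blast
  ultimately have V: "V = A \<union> B" by blast
  show ?thesis
  proof (rule lrw_le_bipartite[OF V])
    show "A \<inter> B = {}" using A2 unfolding B_def by blast
    show "\<not> E x y" if "x \<in> A" "y \<in> A" for x y
      using A2[OF that(1)] A2[OF that(2)] tri[of c1 x y] tri[of c3 x y] tri[of c5 x y] by blast
    show indB: "\<not> E x y" if "x \<in> B" "y \<in> B" for x y
      using B2[OF that(1)] B2[OF that(2)] tri[of c0 x y] tri[of c2 x y] tri[of c4 x y] by blast
    fix u v w y z
    assume uv: "u \<in> B" "v \<in> B" and wyz: "w \<in> A" "y \<in> A" "z \<in> A"
      and n: "\<not> E u w" "\<not> E v w" "E u y" "\<not> E v y" "E v z" "\<not> E u z"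
    have nocommon: "\<not> (E c w \<and> E c y \<and> E c z)" for c
      using skew[of c w y z u v] n indB[OF uv] by (auto simp: E_comm)
    define S where "S p \<longleftrightarrow> E c5 p \<and> E c1 p \<and> \<not> E c3 p" for p
    define T where "T p \<longleftrightarrow> E c1 p \<and> E c3 p \<and> \<not> E c5 p" for p
    define M where "M p \<longleftrightarrow> E c3 p \<and> E c5 p \<and> \<not> E c1 p" for p
    \<comment> \<open>\<open>s\<close>, \<open>t\<close>, \<open>m\<close> alternate with
      \<open>c1\<close>, \<open>c3\<close>, \<open>c5\<close> in another six-cycle, so by
      \<open>c6_nbr\<close> a vertex that sees one of them sees a second one.\<close>
    have hex: "(E u s \<longrightarrow> E u t \<or> E u m) \<and> (E u t \<longrightarrow> E u s \<or> E u m) \<and> (E u m \<longrightarrow> E u s \<or> E u t)"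
      if "S s" "T t" "M m" for s t m
    proof -
      have k0: "cyc6 s c1 t c3 m c5"
        using that by (auto simp: cyc6_def S_def T_def M_def E_comm)
      have k2: "cyc6 t c3 m c5 s c1" "cyc6 m c5 s c1 t c3"
        using k0 by (auto simp: cyc6_def E_comm)
      show ?thesis
        using c6_nbr(1)[OF k0, of u] c6_nbr(1)[OF k2(1), of u] c6_nbr(1)[OF k2(2), of u] by (auto simp: E_comm)
    qed
    \<comment> \<open>Each of \<open>w\<close>, \<open>y\<close>, \<open>z\<close> sees at least two
      of \<open>c1\<close>, \<open>c3\<close>, \<open>c5\<close>, and none of these sees all three.
      So each sees exactly two, and the three pairs are different. But \<open>u\<close> sees only
      \<open>y\<close> among them, against \<open>hex\<close>.\<close>
    have "S w \<and> T y \<and> M z \<or> S w \<and> M y \<and> T z \<or> T w \<and> S y \<and> M z \<or> T w \<and> M y \<and> S z \<or>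
        M w \<and> S y \<and> T z \<or> M w \<and> T y \<and> S z"
      using nocommon[of c1] nocommon[of c3] nocommon[of c5] A2[OF wyz(1)] A2[OF wyz(2)] A2[OF wyz(3)]
      unfolding S_def T_def M_def by argo
    then show False
      using hex n by (elim disjE conjE) blast+
  qed
qed

text \<open>Chords of a closed walk of length seven would produce a triangle or a closed walk of length five.\<close>

definition cyc7 :: "'a \<Rightarrow> 'a \<Rightarrow> 'a \<Rightarrow> 'a \<Rightarrow> 'a \<Rightarrow> 'a \<Rightarrow> 'a \<Rightarrow> bool" where
  "cyc7 c0 c1 c2 c3 c4 c5 c6 \<longleftrightarrow> E c0 c1 \<and> E c1 c2 \<and> E c2 c3 \<and> E c3 c4 \<and> E c4 c5 \<and> E c5 c6 \<and> E c6 c0"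

lemma c7_rotate: "cyc7 c0 c1 c2 c3 c4 c5 c6 \<Longrightarrow> cyc7 c1 c2 c3 c4 c5 c6 c0"
  by (auto simp: cyc7_def)

lemma c7_nbr:
  assumes "cyc7 c0 c1 c2 c3 c4 c5 c6" "E c0 u"
  shows "E c2 u \<or> E c5 u" "\<not> E c1 u" "\<not> E c3 u" "\<not> E c4 u" "\<not> E c6 u"
  using skew[of c0 u c1 c6 c2 c5] tri[of c0 c1 u] tri[of c6 c0 u] no5[of u c0 c1 c2 c3] no5[of u c4 c5 c6 c0]
    tri[of c0 c1 c2] tri[of c5 c6 c0] tri[of c6 c0 c1] no5[of c1 c5 c4 c3 c2] no5[of c2 c6 c0 c1 c2] 
    no5[of c2 c6 c5 c4 c3] no5[of c5 c2 c1 c0 c6] assms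
  unfolding cyc7_def by (auto simp: E_comm)

lemma c7_remote:
  assumes cyc7: "cyc7 c0 c1 c2 c3 c4 c5 c6"
    and u: "\<not> E c0 u" "\<not> E c1 u" "\<not> E c2 u" "\<not> E c3 u" "\<not> E c4 u" "\<not> E c5 u" "\<not> E c6 u" "E u v"
  shows "\<not> E c0 v"
proof
  assume v: "E c0 v"
  note cycle_adj = c7_nbr[OF cyc7 v] and cyc = cyc7[unfolded cyc7_def]
  show False
    using cycle_adj(1)
  proof
    assume "E c2 v"
    then have "cyc7 v c2 c3 c4 c5 c6 c0" using cyc v by (auto simp: cyc7_def E_comm)
    then show False using c7_nbr(1)[of v c2 c3 c4 c5 c6 c0 u] u by (auto simp: E_comm)
  next
    assume "E c5 v"
    then have "cyc7 v c0 c1 c2 c3 c4 c5" using cyc v by (auto simp: cyc7_def E_comm)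
    then show False using c7_nbr(1)[of v c0 c1 c2 c3 c4 c5 u] u by (auto simp: E_comm)
  qed
qed

text \<open>\<open>u\<close> takes the place of \<open>c1\<close>. By \<open>c7_nbr\<close>,
  \<open>y\<close> sees \<open>c3\<close> or \<open>c6\<close>; applied from there to the cycle
  through \<open>u\<close>, the same lemma leaves \<open>u\<close> as the only possible second
  neighbour.\<close>

lemma c7_twin:
  assumes cyc7: "cyc7 c0 c1 c2 c3 c4 c5 c6" and u: "E c0 u" "E c2 u" and y: "E c1 y"
  shows "E u y"
proof -
  have r: "cyc7 c3 c4 c5 c6 c0 u c2" "cyc7 c6 c0 u c2 c3 c4 c5"
    using cyc7 u by (auto simp: cyc7_def E_comm)
  show ?thesis
    using c7_nbr[OF c7_rotate[OF cyc7] y] c7_nbr(1)[OF r(1), of y] c7_nbr(1)[OF r(2), of y] by (auto simp: E_comm)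
qed

text \<open>Every vertex has the neighbourhood of some cycle vertex, so there are at most seven
  different rows and any ordering will do.\<close>

lemma lrw_le_c7:
  assumes cyc7: "cyc7 c0 c1 c2 c3 c4 c5 c6"
  shows "lrw_le 7 V E"
proof -
  note r0 = cyc7 and r1 = c7_rotate[OF cyc7]
  note r2 = c7_rotate[OF r1]
  note r3 = c7_rotate[OF r2]
  note r4 = c7_rotate[OF r3]
  note r5 = c7_rotate[OF r4]
  note r6 = c7_rotate[OF r5]
  let ?C = "[c0, c1, c2, c3, c4, c5, c6]"
  have typed: "\<exists>c\<in>set ?C. E c u" if "u \<in> V" for u
  proof (rule connected_induct[OF _ _ _ that, where P = "\<lambda>u. \<exists>c\<in>set ?C. E c u"])
    show "c0 \<in> V" "\<exists>c\<in>set ?C. E c c0" using cyc7 E_in sym by (auto simp: cyc7_def)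
    show "\<exists>c\<in>set ?C. E c u" if uv: "E u v" "\<exists>c\<in>set ?C. E c v" for u v
    proof (rule ccontr)
      assume "\<not> ?thesis"
      then have u: "\<not> E c0 u" "\<not> E c1 u" "\<not> E c2 u" "\<not> E c3 u" "\<not> E c4 u" "\<not> E c5 u" "\<not> E c6 u"
        by auto
      show False
        using c7_remote[OF r0 u uv(1)] c7_remote[OF r1 u(2-7) u(1) uv(1)]
          c7_remote[OF r2 u(3-7) u(1-2) uv(1)] c7_remote[OF r3 u(4-7) u(1-3) uv(1)]
          c7_remote[OF r4 u(5-7) u(1-4) uv(1)] c7_remote[OF r5 u(6-7) u(1-5) uv(1)]
          c7_remote[OF r6 u(7) u(1-6) uv(1)] uv(2)
        by auto
    qed
  qed
  have twin: "\<forall>y. E u y = E d1 y" if "cyc7 d0 d1 d2 d3 d4 d5 d6" "E d0 u" "E d2 u" for u d0 d1 d2 d3 d4 d5 d6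
  proof -
    have "cyc7 d0 u d2 d3 d4 d5 d6" "E d0 d1" "E d2 d1" using that by (auto simp: cyc7_def E_comm)
    then show ?thesis using c7_twin that by blast
  qed
  have next_to: "\<exists>c\<in>{d1, d6}. \<forall>y. E u y = E c y" if d: "cyc7 d0 d1 d2 d3 d4 d5 d6" "E d0 u" for u d0 d1 d2 d3 d4 d5 d6
  proof -
    have "cyc7 d5 d6 d0 d1 d2 d3 d4" using d by (auto simp: cyc7_def)
    then show ?thesis using twin[OF d] twin[of d5 d6 d0 d1 d2 d3 d4 u] c7_nbr(1)[OF d] d(2) by blast
  qed
  have row: "\<exists>c\<in>set ?C. \<forall>y. E u y = E c y" if "u \<in> V" for u
  proof -
    have "E c0 u \<or> E c1 u \<or> E c2 u \<or> E c3 u \<or> E c4 u \<or> E c5 u \<or> E c6 u"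
      using typed[OF that] by simp
    then show ?thesis
    proof (elim disjE)
      assume "E c0 u" from next_to[OF r0 this] show ?thesis by auto
    next
      assume "E c1 u" from next_to[OF r1 this] show ?thesis by auto
    next
      assume "E c2 u" from next_to[OF r2 this] show ?thesis by auto
    next
      assume "E c3 u" from next_to[OF r3 this] show ?thesis by auto
    next
      assume "E c4 u" from next_to[OF r4 this] show ?thesis by auto
    next
      assume "E c5 u" from next_to[OF r5 this] show ?thesis by auto
    next
      assume "E c6 u" from next_to[OF r6 this] show ?thesis by auto
    qed
  qed
  show ?thesis
  proof (rule lrw_leI[OF finV, where \<Phi> = "\<lambda>_. True"])
    show "cut_rank V E X \<le> 7" if "X \<subseteq> V" for X
    proof -
      have "cut_rank V E X \<le> card (set ?C) + card ({} :: 'a set set)"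
      proof (rule cut_rank_leI[where R = E])
        fix x assume "x \<in> X"
        then obtain c where "c \<in> set ?C" "\<forall>y. E x y = E c y" using row \<open>X \<subseteq> V\<close> by blast
        then show "\<exists>c\<in>set ?C. \<exists>d\<in>insert {} {}. \<forall>y\<in>V - X. E x y \<longleftrightarrow> E c y \<noteq> (y \<in> d)"
          by (intro bexI[of _ c] bexI[of _ "{}"]) auto
      qed auto
      also have "\<dots> \<le> 7" using card_length[of ?C] by simp
      finally show ?thesis .
    qed
  qed auto
qed

section \<open>Longest induced paths on at most six vertices\<close>

definition path5 :: "'a \<Rightarrow> 'a \<Rightarrow> 'a \<Rightarrow> 'a \<Rightarrow> 'a \<Rightarrow> bool" where
  "path5 p1 p2 p3 p4 p5 \<longleftrightarrow> E p1 p2 \<and> E p2 p3 \<and> E p3 p4 \<and> E p4 p5 \<and> \<not> E p1 p4 \<and> \<not> E p2 p5"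

definition path6 :: "'a \<Rightarrow> 'a \<Rightarrow> 'a \<Rightarrow> 'a \<Rightarrow> 'a \<Rightarrow> 'a \<Rightarrow> bool" where
  "path6 p1 p2 p3 p4 p5 p6 \<longleftrightarrow> path5 p1 p2 p3 p4 p5 \<and> path5 p2 p3 p4 p5 p6 \<and> \<not> E p1 p6"

definition path7 :: "'a \<Rightarrow> 'a \<Rightarrow> 'a \<Rightarrow> 'a \<Rightarrow> 'a \<Rightarrow> 'a \<Rightarrow> 'a \<Rightarrow> bool" where
  "path7 p1 p2 p3 p4 p5 p6 p7 \<longleftrightarrow> path6 p1 p2 p3 p4 p5 p6 \<and> path6 p2 p3 p4 p5 p6 p7 \<and> \<not> E p1 p7"

lemma path5_reflect: "path5 p1 p2 p3 p4 p5 \<Longrightarrow> path5 p5 p4 p3 p2 p1"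
  by (auto simp: path5_def E_comm)

lemma path6_reflect: "path6 p1 p2 p3 p4 p5 p6 \<Longrightarrow> path6 p6 p5 p4 p3 p2 p1"
  by (auto simp: path6_def path5_def E_comm)

text \<open>Chords between vertices at distance two close a triangle and \<open>p1 p5\<close> closes
  a five-cycle, so \<open>path5\<close> has to forbid only the chords at distance three.\<close>

lemma path5_chords:
  assumes "path5 p1 p2 p3 p4 p5"
  shows "\<not> E p1 p3" "\<not> E p2 p4" "\<not> E p3 p5" "\<not> E p1 p5"
  using assms tri[of p1 p2 p3] tri[of p2 p3 p4] tri[of p3 p4 p5] no5[of p1 p2 p3 p4 p5]
  unfolding path5_def by (auto simp: E_comm)

text \<open>A vertex \<open>b\<close> of maximal degree reaches everything within distance two.
  Otherwise some \<open>x\<close> is at distance three along \<open>b\<close>, \<open>p\<close>,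
  \<open>q\<close>, \<open>x\<close>; since \<open>q\<close> has the private neighbour
  \<open>x\<close>, the degrees give \<open>b\<close> a neighbour \<open>r\<close> not seen by
  \<open>q\<close>, and \<open>r b p q x\<close> is an induced path.\<close>

lemma lrw_le_no_path5:
  assumes no: "\<And>p1 p2 p3 p4 p5. \<not> path5 p1 p2 p3 p4 p5"
  shows "lrw_le 3 V E"
proof (cases "V = {}")
  case False
  obtain b where b: "b \<in> V" "\<And>u. u \<in> V \<Longrightarrow> card (Collect (E u)) \<le> card (Collect (E b))"
    using finite_ex_max[OF finV False, of "\<lambda>u. card (Collect (E u))"] by blast
  have fin: "finite (Collect (E u))" for u
    by (rule finite_subset[OF _ finV]) (use E_in sym in blast)
  show ?thesis
  proof (rule lrw_le_dominating)
    show "u = b \<or> E b u \<or> (\<exists>a. E b a \<and> E a u)" if "u \<in> V" for u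
    proof (rule connected_induct[OF b(1) _ _ that, where P = "\<lambda>u. u = b \<or> E b u \<or> (\<exists>a. E b a \<and> E a u)"])
      show "x = b \<or> E b x \<or> (\<exists>a. E b a \<and> E a x)"
        if xq: "E x q" "q = b \<or> E b q \<or> (\<exists>a. E b a \<and> E a q)" for x q
      proof (rule ccontr)
        assume far: "\<not> ?thesis"
        then obtain p where p: "E b p" "E p q" "\<not> E b q" using xq sym by blast
        have "x \<in> Collect (E q)" "x \<notin> Collect (E b)" using xq far sym by auto
        moreover have "card (Collect (E q)) \<le> card (Collect (E b))" using b(2) xq(1) E_in sym by blast
        ultimately have "\<not> Collect (E b) \<subseteq> Collect (E q)"
          using card_seteq[OF fin[of q], of "Collect (E b)"] by blast
        then obtain r where r: "E b r" "\<not> E q r" by blast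
        have "path5 r b p q x" using r p xq far by (auto simp: path5_def E_comm)
        then show False using no by blast
      qed
    qed simp
  qed
next
  case True
  have "cut_rank {} E {} \<le> card ({} :: 'a set set) + card ({} :: 'a set set)"
    by (rule cut_rank_leI[where R = "\<lambda>c y. y \<in> c"]) auto
  then show ?thesis using True by (simp add: lrw_le_def)
qed

text \<open>A neighbour of an end that missed \<open>p3\<close> would prolong the path to six
  vertices or close a six-cycle. The last claim is the subdivided claw at \<open>p3\<close> with
  short leg \<open>u\<close> and long legs along the path.\<close>

lemma path5_nbr:
  assumes no6: "\<And>p1 p2 p3 p4 p5 p6. \<not> path6 p1 p2 p3 p4 p5 p6" and c6: "\<And>p1 p2 p3 p4 p5 p6. \<not> cyc6 p1 p2 p3 p4 p5 p6"
    and p: "path5 p1 p2 p3 p4 p5"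
  shows "E p1 u \<Longrightarrow> E p3 u" "E p5 u \<Longrightarrow> E p3 u" "E p3 u \<Longrightarrow> E p1 u \<or> E p5 u"
proof -
  note ch = path5_chords[OF p] and d = p[unfolded path5_def]
  have half: "E q3 u" if q: "path5 q1 q2 q3 q4 q5" and u: "E q1 u" for q1 q2 q3 q4 q5
  proof (rule ccontr)
    assume n: "\<not> E q3 u"
    note d = q[unfolded path5_def] path5_chords[OF q]
    have "\<not> E q2 u" "\<not> E q4 u"
      using d u tri[of q1 q2 u] no5[of u q1 q2 q3 q4] by (auto simp: E_comm)
    moreover have "\<not> E q5 u"
      using c6[of u q1 q2 q3 q4 q5] d u n by (auto simp: cyc6_def E_comm)
    ultimately have "path6 u q1 q2 q3 q4 q5"
      using d u n by (auto simp: path6_def path5_def E_comm)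
    then show False using no6 by blast
  qed
  show "E p1 u \<Longrightarrow> E p3 u" using half[OF p] .
  show "E p5 u \<Longrightarrow> E p3 u" using half[OF path5_reflect[OF p]] .
  show "E p3 u \<Longrightarrow> E p1 u \<or> E p5 u"
    using skew[of p3 u p2 p4 p1 p5] d ch by (auto simp: E_comm)
qed

text \<open>The middle vertex \<open>p3\<close> reaches everything within distance two. For a
  neighbour \<open>v\<close> of a vertex \<open>u\<close> that misses the path, either a subdivided
  claw appears, or \<open>v\<close> replaces \<open>p1\<close>, \<open>p3\<close> or
  \<open>p5\<close>, and \<open>path5_nbr\<close> for the new path contradicts the choice of
  \<open>u\<close>.\<close>

lemma lrw_le_path5:
  assumes no6: "\<And>p1 p2 p3 p4 p5 p6. \<not> path6 p1 p2 p3 p4 p5 p6" and c6: "\<And>p1 p2 p3 p4 p5 p6. \<not> cyc6 p1 p2 p3 p4 p5 p6"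
    and p: "path5 p1 p2 p3 p4 p5"
  shows "lrw_le 3 V E"
proof -
  note ch = path5_chords[OF p] and d = p[unfolded path5_def]
  note nbr = path5_nbr[OF no6 c6]
  define Q where "Q u \<longleftrightarrow> E p2 u \<or> E p3 u \<or> E p4 u" for u
  have typed: "Q u" if "u \<in> V" for u
  proof (rule connected_induct[OF _ _ _ that, where P = Q])
    show "p3 \<in> V" "Q p3" using d E_in sym by (auto simp: Q_def)
    show "Q u" if uv: "E u v" "Q v" for u v
    proof (rule ccontr)
      assume "\<not> Q u"
      then have u: "\<not> E p1 u" "\<not> E p2 u" "\<not> E p3 u" "\<not> E p4 u" "\<not> E p5 u"
        using nbr(1,2)[OF p, of u] by (auto simp: Q_def)
      have t: "\<not> (E p1 v \<and> E p2 v)" "\<not> (E p2 v \<and> E p3 v)" "\<not> (E p3 v \<and> E p4 v)" "\<not> (E p4 v \<and> E p5 v)"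
        "\<not> (E p1 v \<and> E p4 v)" "\<not> (E p2 v \<and> E p5 v)"
        using d tri[of p1 p2 v] tri[of p2 p3 v] tri[of p3 p4 v] tri[of p4 p5 v]
          no5[of v p1 p2 p3 p4] no5[of v p2 p3 p4 p5] by (auto simp: E_comm)
      consider "E p3 v" "E p1 v" "\<not> E p5 v" | "E p3 v" "E p5 v" "\<not> E p1 v" | "E p3 v" "E p1 v" "E p5 v"
        | "E p2 v" "\<not> E p4 v" | "E p4 v" "\<not> E p2 v" | "E p2 v" "E p4 v"
        using uv(2) nbr(3)[OF p, of v] unfolding Q_def by blast
      then show False
      proof cases
        case 1 then show ?thesis using skew[of p3 p2 v p4 u p5] d ch u uv by (auto simp: E_comm)
      next
        case 2 then show ?thesis using skew[of p3 p4 v p2 u p1] d ch u uv by (auto simp: E_comm)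
      next
        case 3 then show ?thesis using skew[of v u p1 p5 p2 p4] d ch u uv by (auto simp: E_comm)
      next
        case 4
        then have "path5 v p2 p3 p4 p5" using d ch t by (auto simp: path5_def E_comm)
        from nbr(1)[OF this, of u] show ?thesis using u uv by (auto simp: E_comm)
      next
        case 5
        then have "path5 v p4 p3 p2 p1" using d ch t by (auto simp: path5_def E_comm)
        from nbr(1)[OF this, of u] show ?thesis using u uv by (auto simp: E_comm)
      next
        case 6
        then have "path5 p1 p2 v p4 p5" using d ch t by (auto simp: path5_def E_comm)
        from nbr(3)[OF this, of u] show ?thesis using u uv by (auto simp: E_comm)
      qed
    qed
  qed
  show ?thesis
  proof (rule lrw_le_dominating[of p3])
    show "u = p3 \<or> E p3 u \<or> (\<exists>a. E p3 a \<and> E a u)" if "u \<in> V" for u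
      using typed[OF that] d sym unfolding Q_def by blast
  qed
qed

lemma path6_nbr:
  assumes no7: "\<And>p1 p2 p3 p4 p5 p6 p7. \<not> path7 p1 p2 p3 p4 p5 p6 p7" and c6: "\<And>p1 p2 p3 p4 p5 p6. \<not> cyc6 p1 p2 p3 p4 p5 p6"
    and c7: "\<And>p1 p2 p3 p4 p5 p6 p7. \<not> cyc7 p1 p2 p3 p4 p5 p6 p7"
    and p: "path6 p1 p2 p3 p4 p5 p6"
  shows "E p1 u \<Longrightarrow> E p3 u" "E p6 u \<Longrightarrow> E p4 u" "E p3 u \<Longrightarrow> E p1 u \<or> E p5 u" "E p4 u \<Longrightarrow> E p2 u \<or> E p6 u"
    "E p3 u \<or> E p5 u \<Longrightarrow> \<not> E p2 u \<and> \<not> E p4 u \<and> \<not> E p6 u" "E p2 u \<or> E p4 u \<Longrightarrow> \<not> E p1 u \<and> \<not> E p3 u \<and> \<not> E p5 u"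
proof -
  have half: "E q1 u \<Longrightarrow> E q3 u" "E q3 u \<Longrightarrow> E q1 u \<or> E q5 u" "E q3 u \<or> E q5 u \<Longrightarrow> \<not> E q2 u \<and> \<not> E q4 u \<and> \<not> E q6 u"
    if q: "path6 q1 q2 q3 q4 q5 q6" for q1 q2 q3 q4 q5 q6
  proof -
    have q': "path5 q1 q2 q3 q4 q5" "path5 q2 q3 q4 q5 q6" "\<not> E q1 q6"
      using q by (auto simp: path6_def)
    note d = q'(1)[unfolded path5_def] path5_chords[OF q'(1)] q'(2)[unfolded path5_def] path5_chords[OF q'(2)] q'(3)
    show *: "E q3 u \<Longrightarrow> E q1 u \<or> E q5 u"
      using skew[of q3 u q2 q4 q1 q5] d by (auto simp: E_comm)
    show "E q3 u \<or> E q5 u \<Longrightarrow> \<not> E q2 u \<and> \<not> E q4 u \<and> \<not> E q6 u"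
      using d tri[of q2 q3 u] tri[of q3 q4 u] tri[of q4 q5 u] tri[of q5 q6 u] no5[of u q3 q4 q5 q6] no5[of u q2 q3 q4 q5]
      by (auto simp: E_comm)
    assume u: "E q1 u"
    show "E q3 u"
    proof (rule ccontr)
      assume n: "\<not> E q3 u"
      have "\<not> E q2 u" "\<not> E q4 u"
        using d u tri[of q1 q2 u] no5[of u q1 q2 q3 q4] by (auto simp: E_comm)
      moreover have "\<not> E q5 u"
        using c6[of u q1 q2 q3 q4 q5] d u n by (auto simp: cyc6_def E_comm)
      moreover have "\<not> E q6 u"
        using c7[of u q1 q2 q3 q4 q5 q6] d u by (auto simp: cyc7_def E_comm)
      ultimately have "path7 u q1 q2 q3 q4 q5 q6"
        using d u n by (auto simp: path7_def path6_def path5_def E_comm)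
      then show False using no7 by blast
    qed
  qed
  show "E p1 u \<Longrightarrow> E p3 u" "E p3 u \<Longrightarrow> E p1 u \<or> E p5 u" "E p3 u \<or> E p5 u \<Longrightarrow> \<not> E p2 u \<and> \<not> E p4 u \<and> \<not> E p6 u"
    using half[OF p] by blast+
  show "E p6 u \<Longrightarrow> E p4 u" "E p4 u \<Longrightarrow> E p2 u \<or> E p6 u" "E p2 u \<or> E p4 u \<Longrightarrow> \<not> E p1 u \<and> \<not> E p3 u \<and> \<not> E p5 u"
    using half[OF path6_reflect[OF p]] by blast+
qed

lemma lrw_le_path6:
  assumes no7: "\<And>p1 p2 p3 p4 p5 p6 p7. \<not> path7 p1 p2 p3 p4 p5 p6 p7" and c6: "\<And>p1 p2 p3 p4 p5 p6. \<not> cyc6 p1 p2 p3 p4 p5 p6"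
    and c7: "\<And>p1 p2 p3 p4 p5 p6 p7. \<not> cyc7 p1 p2 p3 p4 p5 p6 p7"
    and p: "path6 p1 p2 p3 p4 p5 p6"
  shows "lrw_le 3 V E"
proof -
  note nbr = path6_nbr[OF no7 c6 c7]
  note p' = p[unfolded path6_def]
  have p5: "path5 p1 p2 p3 p4 p5" "path5 p2 p3 p4 p5 p6" "\<not> E p1 p6" using p' by auto
  note d = p5(1)[unfolded path5_def] path5_chords[OF p5(1)] p5(2)[unfolded path5_def] path5_chords[OF p5(2)] p5(3)
  have remote: False
    if q: "path6 q1 q2 q3 q4 q5 q6"
      and u: "\<not> E q1 u" "\<not> E q2 u" "\<not> E q3 u" "\<not> E q4 u" "\<not> E q5 u" "\<not> E q6 u"
      and v: "E q3 v \<or> E q5 v" "E u v" for q1 q2 q3 q4 q5 q6 u v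
  proof -
    have q': "path5 q1 q2 q3 q4 q5" "path5 q2 q3 q4 q5 q6" "\<not> E q1 q6"
      using q by (auto simp: path6_def)
    note d = q'(1)[unfolded path5_def] path5_chords[OF q'(1)] q'(2)[unfolded path5_def] path5_chords[OF q'(2)] q'(3)
    note n = nbr[OF q, of v]
    consider "\<not> E q3 v" "E q5 v" "\<not> E q1 v" | "E q3 v" "E q1 v" "\<not> E q5 v" | "E q3 v" "E q5 v" "\<not> E q1 v" | "E q3 v" "E q5 v" "E q1 v"
      using v(1) n(1,3) by blast
    then show False
    proof cases
      case 1
      then have "path6 q1 q2 q3 q4 q5 v" using d n(5) by (auto simp: path6_def path5_def E_comm)
      from nbr(2)[OF this, of u] show ?thesis using u v by (auto simp: E_comm)
    next
      case 2
      then show ?thesis using skew[of q3 q2 v q4 u q5] d u v by (auto simp: E_comm)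
    next
      case 3
      then have "path6 q1 q2 q3 v q5 q6" using d n(5) by (auto simp: path6_def path5_def E_comm)
      from nbr(4)[OF this, of u] show ?thesis using u v by (auto simp: E_comm)
    next
      case 4
      then show ?thesis using skew[of v u q1 q5 q2 q6] d u v by (auto simp: E_comm)
    qed
  qed
  define A where "A = {u. E p3 u \<or> E p5 u}"
  define B where "B = {u. E p2 u \<or> E p4 u}"
  have A: "\<not> E p2 u \<and> \<not> E p4 u \<and> \<not> E p6 u" if "u \<in> A" for u
    using nbr(5)[OF p, of u] that unfolding A_def by blast
  have B: "\<not> E p1 u \<and> \<not> E p3 u \<and> \<not> E p5 u" if "u \<in> B" for u
    using nbr(6)[OF p, of u] that unfolding B_def by blast
  have "u \<in> A \<union> B" if "u \<in> V" for u
  proof (rule connected_induct[OF _ _ _ that, where P = "\<lambda>u. u \<in> A \<union> B"])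
    show "p2 \<in> V" "p2 \<in> A \<union> B" using d E_in sym by (auto simp: A_def)
    show "u \<in> A \<union> B" if uv: "E u v" "v \<in> A \<union> B" for u v
    proof (rule ccontr)
      assume "u \<notin> A \<union> B"
      then have u: "\<not> E p1 u" "\<not> E p2 u" "\<not> E p3 u" "\<not> E p4 u" "\<not> E p5 u" "\<not> E p6 u"
        using nbr(1,2)[OF p, of u] by (auto simp: A_def B_def)
      show False
        using remote[OF p u, of v] remote[OF path6_reflect[OF p] u(6,5,4,3,2,1), of v] uv
        unfolding A_def B_def by blast
    qed
  qed
  moreover have "A \<union> B \<subseteq> V" using E_in sym unfolding A_def B_def by blast
  ultimately have V: "V = A \<union> B" by blast
  have indep: "\<not> E x y" if q: "path6 q1 q2 q3 q4 q5 q6" and xy: "E q3 x \<or> E q5 x" "E q3 y \<or> E q5 y" for q1 q2 q3 q4 q5 q6 x y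
    using tri[of q3 x y] tri[of q5 x y] no5[of x q3 q4 q5 y] no5[of x q5 q4 q3 y] q xy
    unfolding path6_def path5_def by (auto simp: E_comm)
  show ?thesis
  proof (rule lrw_le_bipartite[OF V])
    show "A \<inter> B = {}" using A unfolding B_def by blast
    show indA: "\<not> E x y" if "x \<in> A" "y \<in> A" for x y
      using indep[OF p, of x y] that unfolding A_def by blast
    show indB: "\<not> E x y" if "x \<in> B" "y \<in> B" for x y
      using indep[OF path6_reflect[OF p], of x y] that unfolding B_def by blast
    fix u v w y z
    assume uv: "u \<in> B" "v \<in> B" and wyz: "w \<in> A" "y \<in> A" "z \<in> A"
      and n: "\<not> E u w" "\<not> E v w" "E u y" "\<not> E v y" "E v z" "\<not> E u z"
    have nocommon: "\<not> (E c w \<and> E c y \<and> E c z)" for c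
      using skew[of c w y z u v] n indB[OF uv] by (auto simp: E_comm)
    \<comment> \<open>\<open>S\<close> and \<open>T\<close> collect the vertices that can replace
      \<open>p2\<close> and \<open>p6\<close>; every other vertex of \<open>A\<close> sees both
      \<open>p3\<close> and \<open>p5\<close>.\<close>
    define S where "S a \<longleftrightarrow> E p1 a \<and> E p3 a \<and> \<not> E p5 a" for a
    define T where "T a \<longleftrightarrow> \<not> E p1 a \<and> \<not> E p3 a \<and> E p5 a" for a
    have Q: "path6 p1 s p3 p4 p5 t" if "S s" "T t" for s t
    proof -
      have "s \<in> A" "t \<in> A" using that by (auto simp: A_def S_def T_def)
      then show ?thesis using that d A[of s] A[of t] indA[of s t]
        by (auto simp: S_def T_def path6_def path5_def E_comm)
    qed
    \<comment> \<open>Such an \<open>x\<close> misses the whole path \<open>p1 s p3 p4 p5 t\<close>,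
      since seeing \<open>p4\<close> would force \<open>s\<close> or \<open>t\<close>; then
      \<open>remote\<close> allows it no neighbour in \<open>A\<close>.\<close>
    have avoid: "\<not> E x a" if "S s" "T t" "x \<in> B" "\<not> E x s" "\<not> E x t" "a \<in> A" for x s t a
    proof
      assume "E x a"
      have x: "\<not> E p1 x" "\<not> E p3 x" "\<not> E p5 x" using B that by auto
      have "\<not> E p4 x" using nbr(4)[OF Q[OF that(1,2)], of x] that by (auto simp: E_comm)
      then show False
        using remote[OF Q[OF that(1,2)], of x a] x that \<open>E x a\<close> by (auto simp: A_def E_comm)
    qed
    \<comment> \<open>The neighbours \<open>u\<close> of \<open>s\<close> and \<open>v\<close> of
      \<open>t\<close> both turn out to see \<open>p4\<close>, and \<open>w\<close> sees
      \<open>p3\<close>. Then \<open>w\<close> replaces \<open>p2\<close> or \<open>p4\<close>, or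
      \<open>u\<close> replaces \<open>p3\<close>, and in each new path \<open>path6_nbr\<close>
      makes \<open>w\<close> adjacent to \<open>u\<close> or \<open>v\<close>.\<close>
    have cross: False
      if s: "S s" and t: "T t" and u: "u \<in> B" "E u s" "\<not> E u t" and v: "v \<in> B" "E v t" "\<not> E v s"
        and w: "w \<in> A" "\<not> E u w" "\<not> E v w" for s t u v w
    proof -
      note k = Q[OF s t]
      have sA: "s \<in> A" and tA: "t \<in> A" using s t by (auto simp: A_def S_def T_def)
      note f = A[OF sA] A[OF tA] A[OF w(1)] B[OF u(1)] B[OF v(1)] indB[OF u(1) v(1)] indA[OF sA tA]
      have p4v: "E p4 v" using nbr(2)[OF k, of v] v by (auto simp: E_comm)
      have p3w: "E p3 w"
      proof (rule ccontr)
        assume "\<not> E p3 w"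
        then have "T w" using w(1) nbr(1)[OF p, of w] unfolding A_def T_def by blast
        from nbr(4)[OF Q[OF s this], of v] show False using p4v v w by (auto simp: E_comm)
      qed
      have p4u: "E p4 u"
        using skew[of p3 w s p4 u v] s u v w p3w p4v d f by (auto simp: S_def E_comm)
      consider "E p1 w" "\<not> E p5 w" | "E p5 w" "\<not> E p1 w" | "E p1 w" "E p5 w"
        using nbr(3)[OF p p3w] by blast
      then show False
      proof cases
        case 1
        then have "S w" using p3w by (simp add: S_def)
        from nbr(4)[OF Q[OF this t], of u] show False using p4u u w by (auto simp: E_comm)
      next
        case 2
        then have "path6 p1 s p3 w p5 t"
          using s t d f w p3w indA[OF sA w(1)] indA[OF tA w(1)]
          by (auto simp: S_def T_def path6_def path5_def E_comm)
        from nbr(2)[OF this, of v] show False using v w by (auto simp: E_comm)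
      next
        case 3
        have "path6 p1 s u p4 p5 t"
          using s t d f u p4u by (auto simp: S_def T_def path6_def path5_def E_comm)
        from nbr(1)[OF this, of w] show False using 3 w by (auto simp: E_comm)
      qed
    qed
    have "S x \<or> T x \<or> E p3 x \<and> E p5 x" if "x \<in> A" for x
      using nbr(1,3)[OF p, of x] that unfolding A_def S_def T_def by blast
    note x = this[OF wyz(1)] this[OF wyz(2)] this[OF wyz(3)]
    have st: "(S x \<longrightarrow> E p3 x) \<and> (T x \<longrightarrow> E p5 x) \<and> \<not> (S x \<and> T x)" for x by (auto simp: S_def T_def)
    \<comment> \<open>Neither \<open>p3\<close> nor \<open>p5\<close> sees all of \<open>w\<close>,
      \<open>y\<close>, \<open>z\<close>: one of the three misses \<open>p3\<close> and lies in
      \<open>T\<close>, another misses \<open>p5\<close> and lies in \<open>S\<close>.\<close>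
    have "(S w \<or> S y \<or> S z) \<and> (T w \<or> T y \<or> T z) \<and> \<not> (S w \<and> T w) \<and> \<not> (S y \<and> T y) \<and> \<not> (S z \<and> T z)"
      using nocommon[of p3] nocommon[of p5] x st[of w] st[of y] st[of z] by argo
    then consider "S w" "T y" | "S w" "T z" | "T w" "S y" | "T w" "S z" | "S y" "T z" | "S z" "T y"
      by blast
    then show False
    proof cases
      case 1 then show ?thesis using avoid[of w y v z] uv wyz n by blast
    next
      case 2 then show ?thesis using avoid[of w z u y] uv wyz n by blast
    next
      case 3 then show ?thesis using avoid[of y w v z] uv wyz n by blast
    next
      case 4 then show ?thesis using avoid[of z w u y] uv wyz n by blast
    next
      case 5 then show ?thesis using cross[of y z u v w] uv wyz n by blast
    next
      case 6 then show ?thesis using cross[of z y v u w] uv wyz n by blast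
    qed
  qed
qed

end

section \<open>Long induced paths\<close>

text \<open>Adjacency in the cycle on \<open>0, \<dots>, k\<close>: besides the positions \<open>0, \<dots>, k - 1\<close> of a path,
  there is the type \<open>k\<close> of the vertices that close the path to a cycle.\<close>

definition cycle_adj :: "nat \<Rightarrow> nat \<Rightarrow> nat \<Rightarrow> bool" where
  "cycle_adj k m j \<longleftrightarrow> j = Suc m \<or> m = Suc j \<or> m = 0 \<and> j = k \<or> m = k \<and> j = 0"

text \<open>Only the two ends of the path have a single neighbour on it: their other neighbour on
  the cycle is the missing position \<open>k\<close>.\<close>

lemma cycle_adj_singleton:
  assumes k: "7 \<le> k" and n: "n \<le> k" and s: "s < k" and single: "\<And>j. j < k \<Longrightarrow> cycle_adj k n j \<longleftrightarrow> j = s"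
  shows "n = 0 \<and> s = 1 \<or> n + 1 = k \<and> s + 2 = k"
  using single[of 0] single[of "k - 1"] single[of "Suc n"] single[of "n - 1"] single[of s] k n s
  unfolding cycle_adj_def by presburger

text \<open>No type sees nothing of the path, so type \<open>n'\<close> sees two positions and type
  \<open>n\<close> only one, which makes \<open>n\<close> an end. The two solutions are
  \<open>{1}\<close> inside \<open>{1, 3}\<close> and its mirror image.\<close>

lemma cycle_adj_remove:
  assumes k: "7 \<le> k" and m: "m < k" and n: "n \<le> k" and n': "n' \<le> k"
    and remove: "\<And>j. j < k \<Longrightarrow> cycle_adj k n j \<longleftrightarrow> cycle_adj k n' j \<and> j \<noteq> m" and "cycle_adj k n' m"
  shows "m = 3 \<and> n = 0 \<and> n' = 2 \<or> m + 4 = k \<and> n + 1 = k \<and> n' + 3 = k"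
proof -
  have nonempty: "\<exists>j<k. cycle_adj k n j"
    by (rule exI[of _ "if n = 0 then 1 else n - 1"]) (use n k in \<open>auto simp: cycle_adj_def\<close>)
  consider "n' = 0" | "n' = k" | "n' = k - 1" | "0 < n'" "n' + 1 < k" using n' by linarith
  then show ?thesis
  proof cases
    case 1
    then have "cycle_adj k n' j \<longleftrightarrow> j = 1" if "j < k" for j using that by (auto simp: cycle_adj_def)
    then show ?thesis using nonempty remove \<open>cycle_adj k n' m\<close> m by metis
  next
    case 2
    then have n'_iff: "cycle_adj k n' j \<longleftrightarrow> j = 0 \<or> j = k - 1" if "j < k" for j using that k by (auto simp: cycle_adj_def)
    define s where "s = (if m = 0 then k - 1 else 0)"
    have "cycle_adj k n j \<longleftrightarrow> j = s" if "j < k" for j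
      using remove[OF that] n'_iff[OF that] n'_iff[OF m] \<open>cycle_adj k n' m\<close> k by (auto simp: s_def)
    moreover have "s < k" using k by (simp add: s_def)
    ultimately have "n = 0 \<and> s = 1 \<or> n + 1 = k \<and> s + 2 = k" by (intro cycle_adj_singleton[OF k n])
    moreover have "s = 0 \<or> s = k - 1" by (simp add: s_def)
    ultimately show ?thesis using k by linarith
  next
    case 3
    then have "cycle_adj k n' j \<longleftrightarrow> j = k - 2" if "j < k" for j using that k by (auto simp: cycle_adj_def)
    then show ?thesis using nonempty remove \<open>cycle_adj k n' m\<close> m by metis
  next
    case 4
    then have n'_iff: "cycle_adj k n' j \<longleftrightarrow> j + 1 = n' \<or> j = n' + 1" if "j < k" for j using that by (auto simp: cycle_adj_def)
    then have "m + 1 = n' \<or> m = n' + 1" using \<open>cycle_adj k n' m\<close> m by blast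
    then show ?thesis
    proof
      assume "m + 1 = n'"
      then have "cycle_adj k n j \<longleftrightarrow> j = m + 2" if "j < k" for j using remove[OF that] n'_iff[OF that] by auto
      moreover have "m + 2 < k" using \<open>m + 1 = n'\<close> 4 by linarith
      ultimately have "n = 0 \<and> m + 2 = 1 \<or> n + 1 = k \<and> m + 2 + 2 = k" by (intro cycle_adj_singleton[OF k n])
      then show ?thesis using \<open>m + 1 = n'\<close> by linarith
    next
      assume "m = n' + 1"
      then have "cycle_adj k n j \<longleftrightarrow> j = n' - 1" if "j < k" for j using remove[OF that] n'_iff[OF that] 4 by auto
      moreover have "n' - 1 < k" using 4 by linarith
      ultimately have "n = 0 \<and> n' - 1 = 1 \<or> n + 1 = k \<and> n' - 1 + 2 = k" by (intro cycle_adj_singleton[OF k n])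
      then show ?thesis using \<open>m = n' + 1\<close> 4 m by linarith
    qed
  qed
qed

text \<open>
  The only neighbourhoods on the path that differ in a single position \<open>m\<close> are those of types
  \<open>0\<close> and \<open>2\<close> and their mirror images; \<open>m\<close> itself is then not the type of an exceptional neighbourhood,
  so swapping the roles of the two vertices rules this out.
\<close>

lemma cycle_adj_diff:
  assumes k: "7 \<le> k" and m: "m < k" "n \<le> k" "n' \<le> k"
    and same: "\<And>j. j < k \<Longrightarrow> j \<noteq> m \<Longrightarrow> cycle_adj k n j \<longleftrightarrow> cycle_adj k n' j" and diff: "cycle_adj k n m \<noteq> cycle_adj k n' m"
  shows "m = 3 \<and> (n = 0 \<or> n = 2) \<or> m + 4 = k \<and> (n + 1 = k \<or> n + 3 = k)"
proof (cases "cycle_adj k n m")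
  case True
  have "cycle_adj k n' j \<longleftrightarrow> cycle_adj k n j \<and> j \<noteq> m" if "j < k" for j using same[OF that] True diff by blast
  from cycle_adj_remove[OF k m(1,3,2) this True] show ?thesis by blast
next
  case False
  have "cycle_adj k n j \<longleftrightarrow> cycle_adj k n' j \<and> j \<noteq> m" if "j < k" for j using same[OF that] False diff by blast
  from cycle_adj_remove[OF k m this] show ?thesis using False diff by blast
qed

section \<open>Vertices around a longest induced path\<close>

context c5_free
begin

definition ipath :: "(nat \<Rightarrow> 'a) \<Rightarrow> nat \<Rightarrow> bool" where
  "ipath p k \<longleftrightarrow> (\<forall>i<k. \<forall>j<k. E (p i) (p j) \<longleftrightarrow> j = Suc i \<or> i = Suc j)"

lemma ipathD: "ipath p k \<Longrightarrow> i < k \<Longrightarrow> j < k \<Longrightarrow> E (p i) (p j) \<longleftrightarrow> j = Suc i \<or> i = Suc j"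
  by (simp add: ipath_def)

lemma irrefl: "\<not> E x x"
  using tri[of x x x] by blast

lemma ipath_prepend:
  assumes p: "ipath p k" and u: "\<And>j. j < k \<Longrightarrow> E u (p j) \<longleftrightarrow> j = 0"
  shows "ipath (case_nat u p) (Suc k)"
  unfolding ipath_def
proof (intro allI impI)
  have u': "E (p j) u \<longleftrightarrow> j = 0" if "j < k" for j using u[OF that] sym by blast
  fix i j assume "i < Suc k" "j < Suc k"
  then show "E (case_nat u p i) (case_nat u p j) \<longleftrightarrow> j = Suc i \<or> i = Suc j"
    using u u' irrefl[of u] by (cases i; cases j) (auto simp: ipathD[OF p])
qed

lemma ipath_append:
  assumes p: "ipath p k" and u: "\<And>j. j < k \<Longrightarrow> E u (p j) \<longleftrightarrow> Suc j = k"
  shows "ipath (p(k := u)) (Suc k)"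
  unfolding ipath_def
proof (intro allI impI)
  have u': "E (p j) u \<longleftrightarrow> Suc j = k" if "j < k" for j using u[OF that] sym by blast
  fix i j assume "i < Suc k" "j < Suc k"
  then show "E ((p(k := u)) i) ((p(k := u)) j) \<longleftrightarrow> j = Suc i \<or> i = Suc j"
    using u u' irrefl[of u] by (cases "i = k"; cases "j = k") (auto simp: ipathD[OF p])
qed

text \<open>Neighbours at distance one or three on the path close a triangle or a five-cycle, and an
  inner neighbour needs another one at distance two. If there are two at distance two,
  \<open>f4\<close> to \<open>f6\<close> exclude a third. Otherwise \<open>u\<close> sees at most
  the first two and the last two vertices, and seeing a single end alone would prolong the
  path.\<close>

lemma longest_path_type:
  assumes p: "ipath p k" and k: "7 \<le> k" and max: "\<And>q. \<not> ipath q (Suc k)"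
  shows "(\<forall>i<k. \<not> E u (p i)) \<or> (\<exists>m\<le>k. \<forall>j<k. E u (p j) \<longleftrightarrow> cycle_adj k m j)"
proof -
  note P = ipathD[OF p]
  define a where "a i = E u (p i)" for i
  have a: "E u (p i) = a i" "E (p i) u = a i" for i by (simp_all add: a_def E_comm)
  have f1: "\<not> (a i \<and> a (i + 1))" if "i + 1 < k" for i
    using tri[of u "p i" "p (i + 1)"] that by (auto simp: a P)
  have f3: "\<not> (a i \<and> a (i + 3))" if "i + 3 < k" for i
    using no5[of u "p i" "p (i + 1)" "p (i + 2)" "p (i + 3)"] that by (auto simp: a P)
  have f2: "a i \<or> a (i + 4)" if "a (i + 2)" "i + 4 < k" for i
    using skew[of "p (i + 2)" u "p (i + 1)" "p (i + 3)" "p i" "p (i + 4)"] that by (auto simp: a P)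
  have f4: "\<not> (a i \<and> a (i + 2) \<and> a (i + 4))" if i: "i + 4 < k" for i
  proof
    assume n: "a i \<and> a (i + 2) \<and> a (i + 4)"
    \<comment> \<open>Each case selects a window of seven consecutive path vertices around the five
      in question; this is where \<open>7 \<le> k\<close> gives the room needed.\<close>
    have "i = 0 \<or> i = 0 + 1 \<and> 0 + 6 < k \<or> i = (i - 2) + 2 \<and> (i - 2) + 6 < k" using i k by linarith
    then consider "i = 0" | l where "i = l + 1" "l + 6 < k" | l where "i = l + 2" "l + 6 < k" by blast
    then show False
    proof cases
      case 1
      have "a 6" using skew[of "p 4" "p 3" u "p 5" "p 0" "p 6"] n 1 k by (auto simp: a P)
      then show ?thesis using skew[of u "p 6" "p 0" "p 4" "p 1" "p 3"] n 1 k by (auto simp: a P)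
    next
      case 2
      then show ?thesis
        using skew[of u "p (l + 3)" "p (l + 1)" "p (l + 5)" "p l" "p (l + 6)"] n by (auto simp: a P numeral_eq_Suc)
    next
      case 3
      have "a l" using skew[of "p (l + 2)" "p (l + 3)" u "p (l + 1)" "p (l + 6)" "p l"] n 3
        by (auto simp: a P numeral_eq_Suc)
      then show ?thesis using skew[of u "p l" "p (l + 6)" "p (l + 2)" "p (l + 5)" "p (l + 3)"] n 3
        by (auto simp: a P numeral_eq_Suc)
    qed
  qed
  have f5: "\<not> (a i \<and> a (i + 2) \<and> a j)" if ij: "i + 6 \<le> j" "j < k" for i j
    using skew[of "p (i + 2)" "p (i + 1)" u "p (i + 3)" "p j" "p (i + 4)"] f4[of i] ij by (auto simp: a P)
  have f6: "\<not> (a (l + 2) \<and> a (l + 4) \<and> a j)" if lj: "j + 2 \<le> l" "l + 4 < k" for l j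
    using skew[of "p (l + 2)" "p (l + 3)" u "p (l + 1)" "p j" "p l"] f4[of l] lj by (auto simp: a P numeral_eq_Suc)
  show ?thesis
  proof (cases "\<exists>i. i + 2 < k \<and> a i \<and> a (i + 2)")
    case True
    then obtain i where i: "i + 2 < k" "a i" "a (i + 2)" by blast
    have "a j \<longleftrightarrow> cycle_adj k (i + 1) j" if j: "j < k" for j
    proof
      assume aj: "a j"
      show "cycle_adj k (i + 1) j"
      proof (rule ccontr)
        assume "\<not> cycle_adj k (i + 1) j"
        then have ne: "j \<noteq> i" "j \<noteq> i + 2" by (auto simp: cycle_adj_def)
        consider "j = i + 1" | "j = i + 3" | "j = i + 4" | "j = i + 5" | "j \<ge> i + 6"
          | "i = j + 1" | "i = j + 2" | "i = j + 3" | "i \<ge> j + 4"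
          using ne by linarith
        then show False
        proof cases
          case 9
          define l where "l = i - 2"
          then have "i = l + 2" "j + 2 \<le> l" using 9 by linarith+
          then show ?thesis using f6[of j l] i aj by (auto simp: numeral_eq_Suc)
        qed (use f1[of i] f1[of "i + 2"] f4[of i] f3[of "i + 2"] f5[of i j] f1[of j] f4[of j] f3[of j] i aj j
            in \<open>auto simp: numeral_eq_Suc\<close>)
      qed
    next
      assume "cycle_adj k (i + 1) j"
      then show "a j" using i j by (auto simp: cycle_adj_def)
    qed
    then show ?thesis using i by (intro disjI2 exI[of _ "i + 1"]) (auto simp: a)
  next
    case False
    then have nopair: "\<not> (a i \<and> a (i + 2))" if "i + 2 < k" for i using that by blast
    have inner: "\<not> a (i + 2)" if "i + 4 < k" for i
      using f2[of i] nopair[of i] nopair[of "i + 2"] that by (auto simp: numeral_eq_Suc)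
    \<comment> \<open>The last two positions become \<open>r + 5\<close> and \<open>r + 6\<close>,
      which avoids subtraction.\<close>
    obtain r where r: "k = r + 7" using k by (metis add.commute le_Suc_ex)
    have only: "j = 0 \<or> j = 1 \<or> j = r + 5 \<or> j = r + 6" if "a j" "j < k" for j
    proof (rule ccontr)
      assume "\<not> ?thesis"
      then have "j = (j - 2) + 2" "(j - 2) + 4 < k" using that r by linarith+
      then show False using inner[of "j - 2"] that by metis
    qed
    have g1: "\<not> (a 1 \<and> a (r + 5))" "\<not> (a 1 \<and> a (r + 6))"
      using skew[of "p 1" "p 0" u "p 2" "p (r + 5)" "p 3"] skew[of "p 1" "p 0" u "p 2" "p (r + 6)" "p 3"]
        f4[of 1] nopair[of 1] r by (auto simp: a P numeral_eq_Suc)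
    have g2: "\<not> (a 0 \<and> a (r + 5))"
      using skew[of "p (r + 5)" "p (r + 6)" u "p (r + 4)" "p 0" "p (r + 3)"] nopair[of "r + 3"] r
      by (auto simp: a P numeral_eq_Suc)
    have g3: "\<not> (a 0 \<and> a 1)" "\<not> (a (r + 5) \<and> a (r + 6))"
      using f1[of 0] f1[of "r + 5"] r by (auto simp: numeral_eq_Suc)
    have "\<not> (\<forall>j<k. a j \<longleftrightarrow> j = 0)"
    proof
      assume "\<forall>j<k. a j \<longleftrightarrow> j = 0"
      then have "ipath (case_nat u p) (Suc k)" by (intro ipath_prepend[OF p]) (simp add: a)
      then show False using max by blast
    qed
    then have e0: "\<not> (a 0 \<and> \<not> a 1 \<and> \<not> a (r + 5) \<and> \<not> a (r + 6))" using only by metis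
    have "\<not> (\<forall>j<k. a j \<longleftrightarrow> Suc j = k)"
    proof
      assume "\<forall>j<k. a j \<longleftrightarrow> Suc j = k"
      then have "ipath (p(k := u)) (Suc k)" by (intro ipath_append[OF p]) (simp add: a)
      then show False using max by blast
    qed
    moreover have "Suc j = k \<longleftrightarrow> j = r + 6" for j using r by auto
    ultimately have e1: "\<not> (\<not> a 0 \<and> \<not> a 1 \<and> \<not> a (r + 5) \<and> a (r + 6))" using only by metis
    consider "\<not> a 0" "\<not> a 1" "\<not> a (r + 5)" "\<not> a (r + 6)" | "a 1" "\<not> a 0" "\<not> a (r + 5)" "\<not> a (r + 6)"
      | "a (r + 5)" "\<not> a 0" "\<not> a 1" "\<not> a (r + 6)" | "a 0" "a (r + 6)" "\<not> a 1" "\<not> a (r + 5)"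
      using g1 g2 g3 e0 e1 by blast
    then show ?thesis
    proof cases
      case 1
      then show ?thesis using only unfolding a by metis
    next
      case 2
      then have "\<forall>j<k. E u (p j) \<longleftrightarrow> cycle_adj k 0 j" unfolding a cycle_adj_def using only r by auto
      then show ?thesis by blast
    next
      case 3
      moreover have "cycle_adj k (r + 6) j \<longleftrightarrow> j = r + 5" if "j < k" for j using that r unfolding cycle_adj_def by presburger
      ultimately have "\<forall>j<k. E u (p j) \<longleftrightarrow> cycle_adj k (r + 6) j" unfolding a using only by metis
      then show ?thesis using r by (intro disjI2 exI[of _ "r + 6"]) simp
    next
      case 4
      moreover have "cycle_adj k k j \<longleftrightarrow> j = 0 \<or> j = r + 6" if "j < k" for j using that r unfolding cycle_adj_def by presburger
      ultimately have "\<forall>j<k. E u (p j) \<longleftrightarrow> cycle_adj k k j" unfolding a using only by metis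
      then show ?thesis by blast
    qed
  qed
qed

lemma ipath_swap:
  assumes p: "ipath p k" and m: "m < k" and v: "\<And>j. j < k \<Longrightarrow> E v (p j) \<longleftrightarrow> cycle_adj k m j"
  shows "ipath (p(m := v)) k"
  unfolding ipath_def
proof (intro allI impI)
  have v': "E (p j) v \<longleftrightarrow> cycle_adj k m j" if "j < k" for j using v[OF that] sym by blast
  fix i j assume "i < k" "j < k"
  then show "E ((p(m := v)) i) ((p(m := v)) j) \<longleftrightarrow> j = Suc i \<or> i = Suc j"
    using v v' irrefl[of v] m by (cases "i = m"; cases "j = m") (auto simp: ipathD[OF p] cycle_adj_def)
qed

lemma longest_path_typed:
  assumes p: "ipath p k" and k: "7 \<le> k" and max: "\<And>q. \<not> ipath q (Suc k)" and "u \<in> V"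
  shows "\<exists>m\<le>k. \<forall>j<k. E u (p j) \<longleftrightarrow> cycle_adj k m j"
proof (rule connected_induct[OF _ _ _ assms(4), where P = "\<lambda>u. \<exists>m\<le>k. \<forall>j<k. E u (p j) \<longleftrightarrow> cycle_adj k m j"])
  note P = ipathD[OF p]
  have "E (p 0) (p 1)" using P[of 0 1] k by simp
  then show "p 0 \<in> V" by (rule E_in)
  show "\<exists>m\<le>k. \<forall>j<k. E (p 0) (p j) \<longleftrightarrow> cycle_adj k m j"
    using P[of 0] k by (intro exI[of _ 0]) (auto simp: cycle_adj_def)
  fix u v assume uv: "E u v" and "\<exists>m\<le>k. \<forall>j<k. E v (p j) \<longleftrightarrow> cycle_adj k m j"
  then obtain m where m: "m \<le> k" "\<And>j. j < k \<Longrightarrow> E v (p j) \<longleftrightarrow> cycle_adj k m j" by blast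
  show "\<exists>m\<le>k. \<forall>j<k. E u (p j) \<longleftrightarrow> cycle_adj k m j"
  proof (rule ccontr)
    assume "\<not> ?thesis"
    then have u: "\<not> E u (p i)" if "i < k" for i using longest_path_type[OF p k max, of u] that by blast
    then have u': "\<not> E (p i) u" if "i < k" for i using that sym by blast
    obtain r where r: "k = r + 7" using k by (metis add.commute le_Suc_ex)
    show False
    proof (cases "m = k")
      case True
      \<comment> \<open>Here \<open>v\<close> closes the path to a cycle: dropping the last path
        vertex and prepending \<open>v\<close> and then \<open>u\<close> gives an induced path on
        \<open>k + 1\<close> vertices.\<close>
      have "ipath p (k - 1)" using p by (simp add: ipath_def)
      then have "ipath (case_nat v p) (Suc (k - 1))"
        by (rule ipath_prepend) (use m True k in \<open>auto simp: cycle_adj_def\<close>)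
      then have "ipath (case_nat v p) k" using k by simp
      then have "ipath (case_nat u (case_nat v p)) (Suc k)"
        by (rule ipath_prepend) (use u uv in \<open>auto split: nat.splits\<close>)
      then show False using max by blast
    next
      case False
      then have mk: "m < k" using m by simp
      \<comment> \<open>With \<open>v\<close> at position \<open>m\<close>, \<open>u\<close> sees
        the path in \<open>m\<close> alone. Only the two positions next to the ends are singleton
        neighbourhoods, and there a subdivided claw remains.\<close>
      have q: "ipath (p(m := v)) k" using ipath_swap[OF p mk m(2)] .
      have e: "E u ((p(m := v)) j) \<longleftrightarrow> j = m" if "j < k" for j using u[OF that] uv by auto
      then obtain m' where m': "m' \<le> k" "\<And>j. j < k \<Longrightarrow> j = m \<longleftrightarrow> cycle_adj k m' j"
        using longest_path_type[OF q k max, of u] mk by auto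
      have "cycle_adj k m' j \<longleftrightarrow> j = m" if "j < k" for j using m'(2)[OF that] by blast
      from cycle_adj_singleton[OF k m'(1) mk this] have "m = 1 \<or> m = r + 5" using r by auto
      then show False
      proof
        assume "m = 1"
        then show False using skew[of "p 2" "p 1" v "p 3" u "p 4"] u u' uv m(2) P r by (auto simp: cycle_adj_def sym)
      next
        assume "m = r + 5"
        then show False
          using skew[of "p (r + 4)" "p (r + 5)" v "p (r + 3)" u "p (r + 2)"] u u' uv m(2) P r sym[of u v] sym[of v "p (r + 4)"]
          by (auto simp: cycle_adj_def)
      qed
    qed
  qed
qed

lemma longest_path_blowup:
  assumes p: "ipath p k" and k: "7 \<le> k" and max: "\<And>q. \<not> ipath q (Suc k)"
    and f: "\<And>u. u \<in> V \<Longrightarrow> f u \<le> k \<and> (\<forall>j<k. E u (p j) \<longleftrightarrow> cycle_adj k (f u) j)" and uv: "u \<in> V" "v \<in> V"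
  shows "E u v \<longleftrightarrow> cycle_adj k (f u) (f v)"
proof -
  have swap: "f u = 3 \<and> (f v = 0 \<or> f v = 2) \<or> f u + 4 = k \<and> (f v + 1 = k \<or> f v + 3 = k)"
    if uv: "u \<in> V" "v \<in> V" "f u < k" and ne: "E u v \<noteq> cycle_adj k (f v) (f u)" for u v
  proof -
    \<comment> \<open>Putting \<open>u\<close> at position \<open>f u\<close> leaves all other
      positions unchanged, so the types of \<open>v\<close> on the old and on the new path can
      differ only at \<open>f u\<close>.\<close>
    have q: "ipath (p(f u := u)) k" using ipath_swap[OF p uv(3)] f[OF uv(1)] by blast
    obtain n' where n': "n' \<le> k" "\<And>j. j < k \<Longrightarrow> E v ((p(f u := u)) j) \<longleftrightarrow> cycle_adj k n' j"
      using longest_path_typed[OF q k max uv(2)] by blast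
    have fv: "f v \<le> k" "\<And>j. j < k \<Longrightarrow> E v (p j) \<longleftrightarrow> cycle_adj k (f v) j" using f[OF uv(2)] by blast+
    show ?thesis
    proof (rule cycle_adj_diff[OF k uv(3) fv(1) n'(1)])
      show "cycle_adj k (f v) j \<longleftrightarrow> cycle_adj k n' j" if "j < k" "j \<noteq> f u" for j
        using fv(2)[OF that(1)] n'(2)[OF that(1)] that(2) by simp
      show "cycle_adj k (f v) (f u) \<noteq> cycle_adj k n' (f u)"
        using ne n'(2)[OF uv(3)] E_comm[of u v] by simp blast
    qed
  qed
  have cycle_adj_sym: "cycle_adj k a b = cycle_adj k b a" for a b by (auto simp: cycle_adj_def)
  show ?thesis
  proof (rule ccontr)
    assume ne: "E u v \<noteq> cycle_adj k (f u) (f v)"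
    consider "f u < k" "f v < k" | "f u < k" "f v = k" | "f v < k" "f u = k" | "f u = k" "f v = k"
      using f[OF uv(1)] f[OF uv(2)] by linarith
    then show False
    proof cases
      case 1
      then show ?thesis using swap[OF uv] swap[OF uv(2,1)] ne cycle_adj_sym E_comm[of u v] k by auto
    next
      case 2
      then show ?thesis using swap[OF uv] ne cycle_adj_sym k by auto
    next
      case 3
      then show ?thesis using swap[OF uv(2,1)] ne E_comm[of u v] k by auto
    next
      case 4
      have "E u (p 0)" "E v (p 0)" using f[OF uv(1)] f[OF uv(2)] 4 k by (auto simp: cycle_adj_def)
      then have "\<not> E u v" using tri[of u v "p 0"] by blast
      then show ?thesis using ne 4 k by (auto simp: cycle_adj_def)
    qed
  qed
qed

text \<open>Vertices are ordered by type, with ties in any order; \<open>i\<close> is the type at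
  which the prefix ends. Besides type 0, which is adjacent to the last type \<open>k\<close>, only
  the types \<open>i - 1\<close> and \<open>i\<close> can have neighbours outside the prefix. These
  three rows and a zero default row make 4.\<close>

lemma lrw_le_longest_path:
  assumes p: "ipath p k" and k: "7 \<le> k" and max: "\<And>q. \<not> ipath q (Suc k)"
  shows "lrw_le 4 V E"
proof -
  have "\<exists>f. \<forall>u\<in>V. f u \<le> k \<and> (\<forall>j<k. E u (p j) \<longleftrightarrow> cycle_adj k (f u) j)"
    using longest_path_typed[OF p k max] by (intro bchoice) blast
  then obtain f where f: "\<And>u. u \<in> V \<Longrightarrow> f u \<le> k \<and> (\<forall>j<k. E u (p j) \<longleftrightarrow> cycle_adj k (f u) j)" by blast
  note blowup = longest_path_blowup[OF p k max f]
  define \<Phi> where "\<Phi> X \<longleftrightarrow> (\<exists>i. {u \<in> V. f u < i} \<subseteq> X \<and> X \<subseteq> {u \<in> V. f u \<le> i})" for X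
  show ?thesis
  proof (rule lrw_leI[OF finV, where \<Phi> = \<Phi>])
    show "\<Phi> {}" by (auto simp: \<Phi>_def)
    show "\<exists>v\<in>V - X. \<Phi> (insert v X)" if X: "X \<subset> V" "\<Phi> X" for X
    proof -
      obtain i where i: "{u \<in> V. f u < i} \<subseteq> X" "X \<subseteq> {u \<in> V. f u \<le> i}" using X(2) unfolding \<Phi>_def by blast
      have "finite (V - X)" "V - X \<noteq> {}" using finV X by auto
      then obtain v where v: "v \<in> V - X" "\<And>u. u \<in> V - X \<Longrightarrow> f v \<le> f u"
        by (rule finite_ex_min[of "V - X" f]) auto
      have iX: "i \<le> f y" if "y \<in> V - X" for y
      proof (rule ccontr)
        assume "\<not> i \<le> f y"
        then have "y \<in> {u \<in> V. f u < i}" using that by simp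
        then show False using i(1) that by blast
      qed
      have "u \<in> X" if "u \<in> V" "f u < f v" for u
        using v(2)[of u] that by (cases "u \<in> X") auto
      moreover have "f u \<le> f v" if "u \<in> X" for u
        using iX[OF v(1)] i(2) that by fastforce
      ultimately have "\<Phi> (insert v X)"
        unfolding \<Phi>_def using v(1) X(1) by (intro exI[of _ "f v"]) auto
      then show ?thesis using v(1) by blast
    qed
    show "cut_rank V E X \<le> 4" if X: "X \<subseteq> V" "\<Phi> X" for X
    proof -
      obtain i where i: "{u \<in> V. f u < i} \<subseteq> X" "X \<subseteq> {u \<in> V. f u \<le> i}" using X(2) unfolding \<Phi>_def by blast
      let ?D = "set (map (\<lambda>j. {y. cycle_adj k j (f y)}) [0, i - 1, i])"
      have "cut_rank V E X \<le> card {()} + card ?D"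
      proof (rule cut_rank_leI[where R = "\<lambda>_ _. False"])
        fix x assume x: "x \<in> X"
        have E: "E x y \<longleftrightarrow> cycle_adj k (f x) (f y)" if "y \<in> V - X" for y
          using blowup[of x y] x X(1) that by blast
        show "\<exists>c\<in>{()}. \<exists>d\<in>insert {} ?D. \<forall>y\<in>V - X. E x y \<longleftrightarrow> False \<noteq> (y \<in> d)"
        proof (cases "f x = 0 \<or> f x = i - 1 \<or> f x = i")
          case True
          then have "{y. cycle_adj k (f x) (f y)} \<in> insert {} ?D" by auto
          then show ?thesis using E by (intro bexI[of _ "()"] bexI[of _ "{y. cycle_adj k (f x) (f y)}"]) auto
        next
          case False
          have "\<not> E x y" if y: "y \<in> V - X" for y
          proof -
            have "i \<le> f y"
            proof (rule ccontr)
              assume "\<not> i \<le> f y"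
              then have "y \<in> {u \<in> V. f u < i}" using y by simp
              then show False using i(1) y by blast
            qed
            moreover have "f x \<le> i" "f y \<le> k" using x y i(2) f by auto
            ultimately show ?thesis using E[OF y] False unfolding cycle_adj_def by linarith
          qed
          then show ?thesis by (intro bexI[of _ "()"] bexI[of _ "{}"]) auto
        qed
      qed auto
      also have "\<dots> \<le> 1 + 3"
        using card_length[of "map (\<lambda>j. {y. cycle_adj k j (f y)}) [0, i - 1, i]"] by (intro add_mono) simp_all
      finally show ?thesis by simp
    qed
  qed
qed

lemma path7_ipath:
  assumes "path7 p1 p2 p3 p4 p5 p6 p7"
  shows "ipath (\<lambda>i. [p1, p2, p3, p4, p5, p6, p7] ! i) 7"
  unfolding ipath_def
proof (intro allI impI)
  have p: "path5 p1 p2 p3 p4 p5" "path5 p2 p3 p4 p5 p6" "path5 p3 p4 p5 p6 p7" "\<not> E p1 p6" "\<not> E p2 p7" "\<not> E p1 p7"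
    using assms by (auto simp: path7_def path6_def)
  note d = p(1)[unfolded path5_def] p(2)[unfolded path5_def] p(3)[unfolded path5_def]
    path5_chords[OF p(1)] path5_chords[OF p(2)] path5_chords[OF p(3)] p(4-6)
  have d': "\<not> E p3 p1" "\<not> E p4 p1" "\<not> E p5 p1" "\<not> E p6 p1" "\<not> E p7 p1" "\<not> E p4 p2" "\<not> E p5 p2" "\<not> E p6 p2"
    "\<not> E p7 p2" "\<not> E p5 p3" "\<not> E p6 p3" "\<not> E p7 p3" "\<not> E p6 p4" "\<not> E p7 p4" "\<not> E p7 p5"
    "E p2 p1" "E p3 p2" "E p4 p3" "E p5 p4" "E p6 p5" "E p7 p6"
    using d sym by blast+
  fix i j :: nat assume "i < 7" "j < 7"
  then have "i \<in> {0, 1, 2, 3, 4, 5, 6}" "j \<in> {0, 1, 2, 3, 4, 5, 6}" by auto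
  then show "E ([p1, p2, p3, p4, p5, p6, p7] ! i) ([p1, p2, p3, p4, p5, p6, p7] ! j) \<longleftrightarrow> j = Suc i \<or> i = Suc j"
    by (elim insertE emptyE; hypsubst; insert d d' irrefl; simp)
qed

text \<open>Distinctness is not part of \<open>ipath\<close>, but from four vertices on the
  positions have different neighbourhoods; with three, \<open>p 0\<close> and \<open>p 2\<close> may
  coincide. The bound guarantees that a longest path exists.\<close>

lemma ipath_length_le:
  assumes p: "ipath p k" and k: "4 \<le> k"
  shows "k \<le> card V"
proof -
  note P = ipathD[OF p]
  have less: "p i \<noteq> p j" if ij: "i < j" "j < k" for i j
  proof
    assume eq: "p i = p j"
    show False
    proof (cases i)
      case 0
      then have "j = 2" using P[of 1 i] P[of 1 j] eq ij k by auto
      then show False using P[of 3 i] P[of 3 j] 0 eq k by auto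
    next
      case (Suc l)
      then show False using P[of l i] P[of l j] eq ij by auto
    qed
  qed
  then have "inj_on p {..<k}"
    by (intro inj_onI) (metis lessThan_iff nat_neq_iff)
  moreover have "p ` {..<k} \<subseteq> V"
  proof
    fix x assume "x \<in> p ` {..<k}"
    then obtain i where i: "x = p i" "i < k" by auto
    show "x \<in> V"
    proof (cases "Suc i < k")
      case True
      then show ?thesis using P[of i "Suc i"] i E_in by auto
    next
      case False
      then have "i - 1 < k" "i = Suc (i - 1)" using i k by linarith+
      then have "E (p i) (p (i - 1))" using P[of i "i - 1"] i by auto
      then show ?thesis using E_in i by blast
    qed
  qed
  ultimately show ?thesis
    using card_inj_on_le[OF _ _ finV] by force
qed

lemma lrw_le_long_path:
  assumes "ipath p 7"
  shows "lrw_le 4 V E"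
proof -
  let ?K = "{k. 7 \<le> k \<and> (\<exists>p. ipath p k)}"
  have fin: "finite ?K" by (rule finite_subset[of _ "{..card V}"]) (use ipath_length_le in auto)
  have "Max ?K \<in> ?K" using fin assms by (intro Max_in) auto
  then obtain p where p: "7 \<le> Max ?K" "ipath p (Max ?K)" by blast
  have "\<not> ipath q (Suc (Max ?K))" for q
  proof
    assume "ipath q (Suc (Max ?K))"
    then have "Suc (Max ?K) \<in> ?K" using p(1) by auto
    from Max_ge[OF fin this] show False by simp
  qed
  from lrw_le_longest_path[OF p(2,1) this] show ?thesis .
qed

lemma lrw_le_c5_free: "lrw_le 7 V E"
proof (cases "\<exists>c0 c1 c2 c3 c4 c5. cyc6 c0 c1 c2 c3 c4 c5")
  case True
  then show ?thesis using lrw_le_c6 lrw_le_mono[of 3 V E 7] by auto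
next
  case False
  then have c6: "\<not> cyc6 c0 c1 c2 c3 c4 c5" for c0 c1 c2 c3 c4 c5 by blast
  show ?thesis
  proof (cases "\<exists>c0 c1 c2 c3 c4 c5 c6. cyc7 c0 c1 c2 c3 c4 c5 c6")
    case True
    then show ?thesis using lrw_le_c7 by blast
  next
    case False
    then have c7: "\<not> cyc7 c0 c1 c2 c3 c4 c5 c6" for c0 c1 c2 c3 c4 c5 c6 by blast
    show ?thesis
    proof (cases "\<exists>p1 p2 p3 p4 p5 p6 p7. path7 p1 p2 p3 p4 p5 p6 p7")
      case True
      then obtain p where "ipath p 7" using path7_ipath by blast
      then show ?thesis using lrw_le_long_path lrw_le_mono[of 4 V E 7] by auto
    next
      case False
      then have p7: "\<not> path7 p1 p2 p3 p4 p5 p6 p7" for p1 p2 p3 p4 p5 p6 p7 by blast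
      have "lrw_le 3 V E"
      proof (cases "\<exists>p1 p2 p3 p4 p5 p6. path6 p1 p2 p3 p4 p5 p6")
        case True
        then show ?thesis using lrw_le_path6[OF p7 c6 c7] by blast
      next
        case False
        then have p6: "\<not> path6 p1 p2 p3 p4 p5 p6" for p1 p2 p3 p4 p5 p6 by blast
        show ?thesis
        proof (cases "\<exists>p1 p2 p3 p4 p5. path5 p1 p2 p3 p4 p5")
          case True
          then show ?thesis using lrw_le_path5[OF p6 c6] by blast
        next
          case False
          then show ?thesis using lrw_le_no_path5 by blast
        qed
      qed
      then show ?thesis by (rule lrw_le_mono) simp
    qed
  qed
qed

end

section \<open>From connected graphs to all graphs\<close>

lemma (in connected_skew_free) lrw_le_connected: "lrw_le 20 V E"
proof (cases "\<exists>c0 c1 c2 c3 c4. cyc5 c0 c1 c2 c3 c4")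
  case True
  then show ?thesis using lrw_le_c5 by blast
next
  case False
  then interpret c5_free V E
    by unfold_locales (unfold cyc5_def, blast)
  show ?thesis using lrw_le_c5_free by (rule lrw_le_mono) simp
qed

text \<open>\<open>E_in\<close> requires edges to stay inside the vertex set, so the relation is cut
  down to \<open>T\<close>; \<open>lrw_le_cong\<close> later removes this restriction again.\<close>

lemma (in skew_free) skew_free_closed_subset:
  assumes "T \<subseteq> V"
  shows "skew_free T (\<lambda>x y. x \<in> T \<and> y \<in> T \<and> E x y)"
proof unfold_locales
  show "finite T" using assms finV finite_subset by blast
next
  fix a b c d b' d'
  assume "c \<in> T \<and> a \<in> T \<and> E c a" "c \<in> T \<and> b \<in> T \<and> E c b" "c \<in> T \<and> d \<in> T \<and> E c d"
    "b \<in> T \<and> b' \<in> T \<and> E b b'" "d \<in> T \<and> d' \<in> T \<and> E d d'"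
  then show "a \<in> T \<and> b' \<in> T \<and> E a b' \<or> a \<in> T \<and> d' \<in> T \<and> E a d' \<or> b \<in> T \<and> d' \<in> T \<and> E b d' \<or>
      d \<in> T \<and> b' \<in> T \<and> E d b' \<or> b' \<in> T \<and> d' \<in> T \<and> E b' d'"
    using skew[of c a b d b' d'] by blast
qed (use sym tri in blast)+

lemma skew_free_lrw_le: "skew_free V E \<Longrightarrow> lrw_le 20 V E"
proof (induction "card V" arbitrary: V E rule: less_induct)
  case less
  interpret skew_free V E by (rule less.prems)
  show ?case
  proof (cases "\<forall>T. T \<subset> V \<longrightarrow> T \<noteq> {} \<longrightarrow> (\<exists>x\<in>T. \<exists>y\<in>V - T. E x y)")
    case True
    then interpret connected_skew_free V E by unfold_locales blast
    show ?thesis by (rule lrw_le_connected)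
  next
    case False
    then obtain T where T: "T \<subset> V" "T \<noteq> {}" "\<And>x y. x \<in> T \<Longrightarrow> y \<in> V - T \<Longrightarrow> \<not> E x y" by blast
    have sub: "lrw_le 20 S E" if S: "S \<subset> V" for S
    proof -
      have "card S < card V" using S finV psubset_card_mono by blast
      moreover have "S \<subseteq> V" using S by blast
      ultimately have "lrw_le 20 S (\<lambda>x y. x \<in> S \<and> y \<in> S \<and> E x y)"
        using less.hyps skew_free_closed_subset by blast
      then show ?thesis using lrw_le_cong[of S E "\<lambda>x y. x \<in> S \<and> y \<in> S \<and> E x y"] by simp
    qed
    have "lrw_le 20 (T \<union> (V - T)) E"
    proof (rule lrw_le_disjoint_union)
      show "lrw_le 20 T E" "lrw_le 20 (V - T) E" using sub T by blast+
      show "\<not> E x y \<and> \<not> E y x" if "x \<in> T" "y \<in> V - T" for x y using T(3)[OF that] sym by blast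
    qed blast
    moreover have "T \<union> (V - T) = V" using T by blast
    ultimately show ?thesis by simp
  qed
qed

theorem theorem1p10:
  fixes G :: "'a pair_pre_digraph"
  assumes "pair_graph G"
    and "induced_free {K_3, S_1_2_2} G"
  shows "linear_rank_width G \<le> 58"
proof (rule linear_rank_width_leI)
  interpret pair_graph G by fact
  show "finite (pverts G)" by (rule pair_finite_verts)
  have "lrw_le 20 (pverts G) (\<lambda>u v. (u, v) \<in> parcs G)"
    using skew_free_lrw_le[OF skew_free_of_induced_free[OF assms]] .
  then show "lrw_le 58 (pverts G) (\<lambda>u v. (u, v) \<in> parcs G)"
    by (rule lrw_le_mono) simp
qed

end
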